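(* Let $d\ge 2$, let $\mathcal{H}=(\mathcal{X}(\mathcal{H}),\mathcal{E}(\mathcal{H}))$ be a ($d$-uniform) generalized chordal hypergraph and let $k$ be a field of arbitrary characteristic. Then the Stanley-Reisner ring $R/I_{\Delta_{\mathcal{H}}}$ of the complex $\Delta_{\mathcal{H}}$ has linear resolution.
   Context: A hypergraph $\mathcal{H}$ consists of a finite vertex set $\mathcal{X}(\mathcal{H})$ and a finite set $\mathcal{E}(\mathcal{H})$ of non-empty subsets of $\mathcal{X}(\mathcal{H})$, called edges. It is $d$-uniform if every edge has exactly $d$ elements. Hypergraphs are simple (edges have at least 2 elements and no edge is contained in another), so $d\ge2$. Natural numbers include $0$. For a finite set $F$, $\binom{F}{d}$ is the set of all $d$-element subsets of $F$. $K_n^d$ ($n\in\mathbb{N}$) is the hypergraph on $n$ vertices whose edges are all $d$-element subsets of the vertex set; if $n<d$ it consists of $n$ isolated vertices and has no edges. Generalized chordal: the class of generalized chordal ($d$-uniform) hypergraphs is defined inductively (up to isomorphism) as follows. (1) Every $K_n^d$, $n\in\mathbb{N}$, is generalized chordal. (2) If $\mathcal{G}$ is generalized chordal, then so is $\mathcal{G}\bigcup_{K_j^d}K_i^d$ for $0\le j<i$; this is obtained by choosing a $j$-element set of vertices of $\mathcal{G}$ whose induced hypergraph is $K_j^d$ (all its $d$-element subsets are edges of $\mathcal{G}$; automatic if $j<d$), identifying these vertices with $j$ of the vertices of $K_i^d$, and taking the union of the vertex sets and the union of the edge sets (the other $i-j$ vertices of $K_i^d$ are new). (3) If $\mathcal{G}$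 is generalized chordal and $E\subseteq\mathcal{X}(\mathcal{G})$ with $|E|=d$ is such that at least one element of $\binom{E}{d-1}$ is not a subset of any edge of $\mathcal{G}$, then the hypergraph $\mathcal{G}\cup E$ with vertex set $\mathcal{X}(\mathcal{G})$ and edge set $\mathcal{E}(\mathcal{G})\cup\{E\}$ is generalized chordal. Complex of $\mathcal{H}$: $\Delta_{\mathcal{H}}=\{F\subseteq\mathcal{X}(\mathcal{H}) : \binom{F}{d}\subseteq\mathcal{E}(\mathcal{H})\}$, a simplicial complex (it contains every $F$ with $|F|<d$). $R=k[x_1,\ldots,x_n]$ is the polynomial ring with one variable for each vertex of $\mathcal{H}$ ($n=|\mathcal{X}(\mathcal{H})|$), standard graded. For a simplicial complex $\Delta$ on the vertex set, $I_\Delta\subseteq R$ is the Stanley-Reisner ideal, generated by the squarefree monomials $x^F=\prod_{j\in F}x_j$ with $F\notin\Delta$. For a finitely generated graded $R$-module $M$, $\beta_{i,j}(M)$ denotes its graded Betti numbers (the number of summands $R(-j)$ in homological degree $i$ of the minimal graded free resolution). $M$ has linear resolution if there is a fixed natural number $e\ge1$ such that for all $i>0$, $\beta_{i,j}(M)=0$ whenever $j\ne i+e-1$. *)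

theory Defs
  imports "HOL-Algebra.QuotRing" "HOL-Algebra.Module"
    "HOL-Library.Poly_Mapping" "HOL-Library.Ramsey"
begin

section \<open>Generalized chordal hypergraphs\<close>

text \<open>
  A \<open>d\<close>-uniform hypergraph is given by its vertex set \<open>X\<close> and its edge set \<open>E\<close>;
  the set of \<open>d\<close>-element subsets of \<open>F\<close> is \<^term>\<open>nsets F d\<close>.
  The inductive clauses use actual vertex sets instead of isomorphism types: the complete
  hypergraph lives on an arbitrary finite set, and gluing a complete hypergraph along a
  \<open>j\<close>-element set \<open>A\<close> means adjoining a set \<open>B\<close> of \<open>i - j > 0\<close> new vertices.  The class is
  closed under isomorphism, see \<open>generalized_chordal_image\<close>.
\<close>

inductive generalized_chordal :: "nat \<Rightarrow> 'v set \<Rightarrow> 'v set set \<Rightarrow> bool" for d where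
  complete: "finite X \<Longrightarrow> generalized_chordal d X (nsets X d)"
| glue: "\<lbrakk>generalized_chordal d X E; A \<subseteq> X; nsets A d \<subseteq> E;
    finite B; B \<noteq> {}; B \<inter> X = {}\<rbrakk>
    \<Longrightarrow> generalized_chordal d (X \<union> B) (E \<union> nsets (A \<union> B) d)"
| add_edge: "\<lbrakk>generalized_chordal d X E; e \<in> nsets X d;
    \<exists>S \<in> nsets e (d - 1). \<forall>e' \<in> E. \<not> S \<subseteq> e'\<rbrakk>
    \<Longrightarrow> generalized_chordal d X (insert e E)"

lemma generalized_chordal_uniform:
  assumes "generalized_chordal d X E"
  shows "finite X" "E \<subseteq> nsets X d"
  using assms by (induction) (auto simp: nsets_def)

lemma nsets_image:
  assumes "inj_on f A"
  shows "nsets (f ` A) d = (\<lambda>e. f ` e) ` nsets A d"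
  using bij_betw_nsets[of f A "f ` A" d] assms by (simp add: bij_betw_def)

lemma generalized_chordal_image:
  assumes "generalized_chordal d X E" "inj_on f X"
  shows "generalized_chordal d (f ` X) ((\<lambda>e. f ` e) ` E)"
  using assms
proof (induction)
  case (complete X)
  then show ?case
    by (metis finite_imageI generalized_chordal.complete nsets_image)
next
  case (glue X E A B)
  have inj: "inj_on f X" "inj_on f A" "inj_on f (A \<union> B)"
    using glue.prems glue.hyps by (auto intro: inj_on_subset)
  have "nsets (f ` A) d \<subseteq> (\<lambda>e. f ` e) ` E"
    using nsets_image[OF inj(2), of d] glue.hyps by auto
  moreover have "f ` B \<inter> f ` X = {}"
    using glue.prems glue.hyps(6) by (auto simp: inj_on_def)
  ultimately have "generalized_chordal d (f ` X \<union> f ` B)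
      ((\<lambda>e. f ` e) ` E \<union> nsets (f ` A \<union> f ` B) d)"
    using glue.hyps glue.IH[OF inj(1)] by (intro generalized_chordal.glue) auto
  then show ?case
    using nsets_image[OF inj(3), of d] by (simp add: image_Un)
next
  case (add_edge X E e)
  obtain S where S: "S \<in> nsets e (d - 1)" "\<forall>e' \<in> E. \<not> S \<subseteq> e'"
    using add_edge.hyps by blast
  have eX: "e \<subseteq> X" and EX: "\<And>e'. e' \<in> E \<Longrightarrow> e' \<subseteq> X"
    using add_edge.hyps generalized_chordal_uniform(2)[OF add_edge.hyps(1)]
    by (auto simp: nsets_def)
  have inj: "inj_on f e" using eX add_edge.prems by (blast intro: inj_on_subset)
  have "f ` e \<in> nsets (f ` X) d"
    using nsets_image[OF add_edge.prems, of d] add_edge.hyps by blast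
  moreover have "f ` S \<in> nsets (f ` e) (d - 1)"
    using nsets_image[OF inj, of "d - 1"] S by blast
  moreover have "\<not> f ` S \<subseteq> f ` e'" if "e' \<in> E" for e'
  proof -
    have "S \<subseteq> X" using S eX by (auto simp: nsets_def)
    have "S \<subseteq> e'" if sub: "f ` S \<subseteq> f ` e'"
    proof
      fix x assume x: "x \<in> S"
      with sub obtain y where y: "y \<in> e'" "f x = f y" by blast
      with x \<open>S \<subseteq> X\<close> EX[OF \<open>e' \<in> E\<close>] have "x = y"
        by (auto intro: inj_onD[OF add_edge.prems])
      with y show "x \<in> e'" by simp
    qed
    then show ?thesis using S(2) that by blast
  qed
  ultimately have "generalized_chordal d (f ` X) (insert (f ` e) ((\<lambda>e. f ` e) ` E))"
    using add_edge.IH[OF add_edge.prems] by (intro generalized_chordal.add_edge) blast+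
  then show ?case by simp
qed

definition hypergraph_complex :: "nat \<Rightarrow> 'v set \<Rightarrow> 'v set set \<Rightarrow> 'v set set" where
  "hypergraph_complex d X E = {F. F \<subseteq> X \<and> nsets F d \<subseteq> E}"


section \<open>Polynomial rings with one variable for each vertex\<close>

text \<open>
  The type \<open>('v, 'k) mpoly\<close> consists of the polynomials in variables indexed by the whole
  type \<open>'v\<close>; \<open>k[X]\<close> is its subring of polynomials involving only variables from \<open>X\<close>.
\<close>

type_synonym ('v, 'k) mpoly = "('v \<Rightarrow>\<^sub>0 nat) \<Rightarrow>\<^sub>0 'k"

definition poly_ring :: "'v set \<Rightarrow> ('v, 'k::field) mpoly ring" where
  "poly_ring X =
    \<lparr>carrier = {p. \<forall>m \<in> Poly_Mapping.keys p. Poly_Mapping.keys m \<subseteq> X},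
     mult = (*), one = 1, zero = 0, add = (+)\<rparr>"

definition var :: "'v \<Rightarrow> ('v, 'k::field) mpoly" where
  "var v = Poly_Mapping.single (Poly_Mapping.single v 1) 1"

definition mon_degree :: "('v \<Rightarrow>\<^sub>0 nat) \<Rightarrow> nat" where
  "mon_degree m = (\<Sum>v \<in> Poly_Mapping.keys m. Poly_Mapping.lookup m v)"

text \<open>The graded component \<open>R\<^sub>j\<close>, which is \<open>0\<close> for \<open>j < 0\<close>.\<close>

definition homogeneous :: "'v set \<Rightarrow> int \<Rightarrow> ('v, 'k::field) mpoly set" where
  "homogeneous X j =
    {p \<in> carrier (poly_ring X). \<forall>m \<in> Poly_Mapping.keys p. int (mon_degree m) = j}"

text \<open>The graded maximal ideal: polynomials without constant term.\<close>

definition irrelevant_ideal :: "'v set \<Rightarrow> ('v, 'k::field) mpoly set" where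
  "irrelevant_ideal X = {p \<in> carrier (poly_ring X). Poly_Mapping.lookup p 0 = 0}"


section \<open>Graded modules and graded Betti numbers\<close>

record ('a, 'b) graded_module = "('a, 'b) module" +
  component :: "int \<Rightarrow> 'b set"

definition graded_hom ::
    "('a, 'r) ring_scheme \<Rightarrow> ('a, 'b, 'm) graded_module_scheme
      \<Rightarrow> ('a, 'c, 'n) graded_module_scheme \<Rightarrow> ('b \<Rightarrow> 'c) set" where
  "graded_hom R M N = {f \<in> carrier M \<rightarrow> carrier N.
    (\<forall>x \<in> carrier M. \<forall>y \<in> carrier M. f (x \<oplus>\<^bsub>M\<^esub> y) = f x \<oplus>\<^bsub>N\<^esub> f y) \<and>
    (\<forall>r \<in> carrier R. \<forall>x \<in> carrier M. f (r \<odot>\<^bsub>M\<^esub> x) = r \<odot>\<^bsub>N\<^esub> f x) \<and>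
    (\<forall>j. f ` component M j \<subseteq> component N j)}"

text \<open>
  For a list of integers \<open>a\<close>, the graded free module \<open>\<Oplus>\<^bsub>b\<^esub> R(- a ! b)\<close>,
  \<open>b < length a\<close>, over \<open>R = k[X]\<close>.  Its elements are represented by functions on \<open>nat\<close>
  vanishing from \<open>length a\<close> on.  The ring multiplication and unit inherited from the
  record of modules are irrelevant.
\<close>

definition graded_free ::
    "'v set \<Rightarrow> int list
      \<Rightarrow> (('v, 'k::field) mpoly, nat \<Rightarrow> ('v, 'k) mpoly) graded_module" where
  "graded_free X a =
    \<lparr>carrier = {x. (\<forall>b < length a. x b \<in> carrier (poly_ring X)) \<and> (\<forall>b \<ge> length a. x b = 0)},
     mult = undefined, one = undefined,
     zero = (\<lambda>b. 0), add = (\<lambda>x y b. x b + y b),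
     smult = (\<lambda>p x b. p * x b),
     component = (\<lambda>j. {x. (\<forall>b < length a. x b \<in> homogeneous X (j - a ! b)) \<and>
                           (\<forall>b \<ge> length a. x b = 0)})\<rparr>"

text \<open>
  A minimal graded free resolution of \<open>M\<close> over \<open>k[X]\<close>:
  \<open>\<dots> \<rightarrow> F\<^sub>2 \<rightarrow> F\<^sub>1 \<rightarrow> F\<^sub>0 \<rightarrow> M \<rightarrow> 0\<close> with \<open>F\<^sub>i = graded_free X (a i)\<close>, differentials
  \<open>\<delta> i : F\<^bsub>i+1\<^esub> \<rightarrow> F\<^sub>i\<close> and augmentation \<open>\<epsilon> : F\<^sub>0 \<rightarrow> M\<close>.  The last clause is
  minimality: the image of \<open>\<delta> i\<close> lies in the product of the irrelevant ideal with \<open>F\<^sub>i\<close>.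
\<close>

definition minimal_graded_free_resolution ::
    "'v set \<Rightarrow> (('v, 'k::field) mpoly, 'b, 'm) graded_module_scheme
      \<Rightarrow> (nat \<Rightarrow> int list)
      \<Rightarrow> (nat \<Rightarrow> (nat \<Rightarrow> ('v, 'k) mpoly) \<Rightarrow> (nat \<Rightarrow> ('v, 'k) mpoly))
      \<Rightarrow> ((nat \<Rightarrow> ('v, 'k) mpoly) \<Rightarrow> 'b) \<Rightarrow> bool" where
  "minimal_graded_free_resolution X M a \<delta> \<epsilon> \<longleftrightarrow>
    \<epsilon> \<in> graded_hom (poly_ring X) (graded_free X (a 0)) M \<and>
    (\<forall>i. \<delta> i \<in> graded_hom (poly_ring X) (graded_free X (a (Suc i))) (graded_free X (a i))) \<and>
    \<epsilon> ` carrier (graded_free X (a 0)) = carrier M \<and>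
    \<delta> 0 ` carrier (graded_free X (a 1)) = a_kernel (graded_free X (a 0)) M \<epsilon> \<and>
    (\<forall>i. \<delta> (Suc i) ` carrier (graded_free X (a (Suc (Suc i)))) =
          a_kernel (graded_free X (a (Suc i))) (graded_free X (a i)) (\<delta> i)) \<and>
    (\<forall>i. \<forall>x \<in> carrier (graded_free X (a (Suc i))). \<forall>b < length (a i).
          \<delta> i x b \<in> irrelevant_ideal X)"

text \<open>
  The number of summands \<open>R(-j)\<close> in homological degree \<open>i\<close> of the minimal graded free
  resolution, for a finitely generated graded module \<open>M\<close> over \<open>k[X]\<close>, \<open>X\<close> finite.  By
  existence and uniqueness of minimal resolutions the description is then well defined.
\<close>

definition graded_betti ::
    "'v set \<Rightarrow> (('v, 'k::field) mpoly, 'b, 'm) graded_module_scheme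
      \<Rightarrow> nat \<Rightarrow> int \<Rightarrow> nat" where
  "graded_betti X M i j =
    (THE n. \<exists>a \<delta> \<epsilon>. minimal_graded_free_resolution X M a \<delta> \<epsilon> \<and> n = count_list (a i) j)"

definition has_linear_resolution ::
    "'v set \<Rightarrow> (('v, 'k::field) mpoly, 'b, 'm) graded_module_scheme \<Rightarrow> bool" where
  "has_linear_resolution X M \<longleftrightarrow>
    (\<exists>e::nat. 1 \<le> e \<and> (\<forall>i>0. \<forall>j. j \<noteq> int i + int e - 1 \<longrightarrow> graded_betti X M i j = 0))"


section \<open>Stanley-Reisner rings\<close>

definition stanley_reisner_ideal :: "'v set \<Rightarrow> 'v set set \<Rightarrow> ('v, 'k::field) mpoly set" where
  "stanley_reisner_ideal X \<Delta> =
    genideal (poly_ring X) {\<Prod>v\<in>F. var v | F. F \<subseteq> X \<and> F \<notin> \<Delta>}"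

text \<open>
  The residue class ring \<open>R/I\<close> as a graded module over \<open>R = k[X]\<close>, for a homogeneous
  ideal \<open>I\<close>.
\<close>

definition quotient_module ::
    "'v set \<Rightarrow> ('v, 'k::field) mpoly set
      \<Rightarrow> (('v, 'k) mpoly, ('v, 'k) mpoly set) graded_module" where
  "quotient_module X I = ring.extend (poly_ring X Quot I)
    \<lparr>smult = (\<lambda>p C. (I +>\<^bsub>poly_ring X\<^esub> p) \<otimes>\<^bsub>poly_ring X Quot I\<^esub> C),
     component = (\<lambda>j. (\<lambda>p. I +>\<^bsub>poly_ring X\<^esub> p) ` homogeneous X j)\<rparr>"

definition stanley_reisner_ring ::
    "'v set \<Rightarrow> 'v set set
      \<Rightarrow> (('v, 'k::field) mpoly, ('v, 'k) mpoly set) graded_module" where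
  "stanley_reisner_ring X \<Delta> = quotient_module X (stanley_reisner_ideal X \<Delta>)"

end

theory Submission
  imports Defs "HOL-Library.Function_Algebras"
begin

text \<open>
  Call a graded module linear in degree \<open>q\<close> if it is generated by finitely many elements of degree
  \<open>q\<close>, the relations between them are generated by relations with linear coefficients, the
  relations between those likewise, and so on without end.  This is the coinductive predicate
  \<open>linear_module\<close>; it says that the module has a minimal free resolution with all generators of the
  \<open>i\<close>-th free module in degree \<open>q + i\<close>.  Instead of the long exact sequence of Tor, three closure
  properties are proved by working with generators and relations.  For an exact sequence
  \<open>0 \<rightarrow> A \<rightarrow> B \<rightarrow> C \<rightarrow> 0\<close>, if \<open>A\<close> and \<open>C\<close> are linear in degree \<open>q\<close> then so is \<open>B\<close> (\<open>linear_extension\<close>),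
  and if \<open>A\<close> is linear in degree \<open>q + 1\<close> and \<open>B\<close> in degree \<open>q\<close> then \<open>C\<close> is linear in degree \<open>q\<close>
  (\<open>linear_quotient\<close>).  Finally, direct summands of linear modules are linear (\<open>linear_summand\<close>).

  The Stanley-Reisner ideal of the complex of a \<open>d\<close>-uniform hypergraph is generated by the squarefree
  monomials of the non-edges, that is, of the \<open>d\<close>-sets of vertices that are not edges.  The closure
  properties are applied to the Mayer-Vietoris sequence \<open>0 \<rightarrow> I \<inter> J \<rightarrow> I \<oplus> J \<rightarrow> I + J \<rightarrow> 0\<close> of two such
  ideals.  Complete hypergraphs have the zero ideal.  Gluing a complete hypergraph on \<open>A \<union> {b}\<close> along
  \<open>A\<close>, with a new vertex \<open>b\<close>, replaces \<open>I\<close> by \<open>I + x J\<close>, where \<open>x\<close> is the variable of \<open>b\<close> and \<open>J\<close> is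
  generated by the \<open>(d - 1)\<close>-sets of old vertices not contained in \<open>A\<close>; here \<open>J\<close> is linear in degree
  \<open>d - 1\<close> and \<open>I \<inter> x J = x I\<close> is linear in degree \<open>d + 1\<close> (\<open>linear_family_glue_vertex\<close>).

  Adding an edge \<open>e\<close> that has a \<open>(d - 1)\<close>-subset \<open>S\<close> in no other edge removes a generator from the ideal
  \<open>I\<close>, leaving an ideal \<open>I'\<close>.  Let \<open>L\<close> be generated by all \<open>d\<close>-sets that contain \<open>S\<close>.  Since none of
  these sets is an old edge, \<open>I' + L = I\<close>, and \<open>I' \<inter> L\<close> is generated by the \<open>d\<close>-sets other than \<open>e\<close> that contain
  \<open>S\<close>.  Up to a monomial factor \<open>I' \<inter> L\<close> is an ideal generated by variables and hence linear.  So both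
  ends of the sequence are linear in degree \<open>d\<close>, then so is \<open>I' \<oplus> L\<close>, and so is its summand \<open>I'\<close>
  (\<open>linear_family_add_edge\<close>).

  It remains to pass from linearity to graded Betti numbers.  Unfolding the coinductive predicate
  gives a minimal resolution of the residue class ring (\<open>linear_resolution_exists\<close>).  Conversely,
  two minimal lists of generators of a linear module have isomorphic relation modules
  (\<open>linear_syz_minimal\<close>), so all minimal resolutions have the same twists
  (\<open>minimal_resolution_linear\<close>).
\<close>

section \<open>Polynomials with prescribed monomials\<close>

text \<open>
  The ideals, graded components and polynomial rings of this development are all spanned by sets
  of monomials.  Spans of monomials are closed under addition, and disjoint sets of monomials
  have spans that meet in \<open>0\<close>.
\<close>

definition mons_in :: "('v \<Rightarrow>\<^sub>0 nat) set \<Rightarrow> ('v, 'k::field) mpoly set" where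
  "mons_in S = {p. Poly_Mapping.keys p \<subseteq> S}"

abbreviation polys :: "'v set \<Rightarrow> ('v, 'k::field) mpoly set" where
  "polys Y \<equiv> carrier (poly_ring Y)"

lemma mons_in_zero [simp]: "0 \<in> mons_in S"
  by (simp add: mons_in_def)

lemma mons_in_add: "p \<in> mons_in S \<Longrightarrow> q \<in> mons_in S \<Longrightarrow> p + q \<in> mons_in S"
  using keys_add[of p q] by (auto simp: mons_in_def)

lemma mons_in_uminus: "p \<in> mons_in S \<Longrightarrow> - p \<in> mons_in S"
  by (auto simp: mons_in_def in_keys_iff)

lemma mons_in_mult:
  assumes "p \<in> mons_in S" "q \<in> mons_in T" "\<And>a b. a \<in> S \<Longrightarrow> b \<in> T \<Longrightarrow> a + b \<in> U"
  shows "p * q \<in> mons_in U"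
proof -
  have "Poly_Mapping.keys (p * q) \<subseteq> U"
    using keys_mult[of p q] assms unfolding mons_in_def by blast
  then show ?thesis by (simp add: mons_in_def)
qed

lemma mons_in_disjoint:
  assumes "p \<in> mons_in S" "p \<in> mons_in T" "S \<inter> T = {}"
  shows "p = 0"
proof -
  have "Poly_Mapping.keys p = {}" using assms unfolding mons_in_def by blast
  then show ?thesis by (metis in_keys_iff empty_iff lookup_zero poly_mapping_eqI)
qed

lemma mons_in_split:
  assumes "p \<in> mons_in (S \<union> T)"
  obtains q r where "q \<in> mons_in S" "r \<in> mons_in (T - S)" "p = q + r"
proof
  define q where "q = Poly_Mapping.mapp (\<lambda>m c. c when m \<in> S) p"
  have q: "Poly_Mapping.lookup q m = (Poly_Mapping.lookup p m when m \<in> S)" for m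
    by (cases "m \<in> S") (auto simp: q_def lookup_mapp when_def in_keys_iff)
  show "q \<in> mons_in S"
    by (auto simp: mons_in_def in_keys_iff q)
  show "p - q \<in> mons_in (T - S)"
    using assms by (auto simp: mons_in_def in_keys_iff q lookup_minus when_def split: if_splits)
  show "p = q + (p - q)" by simp
qed

lemma polys_eq: "polys Y = mons_in {m. Poly_Mapping.keys m \<subseteq> Y}"
  by (auto simp: poly_ring_def mons_in_def)

lemma homogeneous_eq:
  "homogeneous Y j = mons_in {m. Poly_Mapping.keys m \<subseteq> Y \<and> int (mon_degree m) = j}"
  by (auto simp: homogeneous_def poly_ring_def mons_in_def)

lemma keys_add_nat:
  fixes a b :: "'v \<Rightarrow>\<^sub>0 nat"
  shows "Poly_Mapping.keys (a + b) = Poly_Mapping.keys a \<union> Poly_Mapping.keys b"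
  by (auto simp: in_keys_iff lookup_add)

lemma mon_degree_add: "mon_degree (a + b) = mon_degree a + mon_degree b"
  unfolding mon_degree_def using setsum_keys_plus_distrib[of "\<lambda>_ n. n" a b] by simp

lemma mon_degree_eq_0: "mon_degree m = 0 \<longleftrightarrow> m = 0"
  unfolding mon_degree_def by (auto simp: in_keys_iff intro: poly_mapping_eqI)

lemma polys_zero [simp]: "0 \<in> polys Y" by (simp add: polys_eq)
lemma polys_one [simp]: "1 \<in> polys Y" by (simp add: polys_eq mons_in_def)
lemma polys_add [intro]: "p \<in> polys Y \<Longrightarrow> q \<in> polys Y \<Longrightarrow> p + q \<in> polys Y"
  by (simp add: polys_eq mons_in_add)
lemma polys_uminus [intro]: "p \<in> polys Y \<Longrightarrow> - p \<in> polys Y"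
  by (simp add: polys_eq mons_in_uminus)
lemma polys_mult [intro]: "p \<in> polys Y \<Longrightarrow> q \<in> polys Y \<Longrightarrow> p * q \<in> polys Y"
  unfolding polys_eq by (rule mons_in_mult) (auto simp: keys_add_nat)

lemma homogeneous_polys: "p \<in> homogeneous Y j \<Longrightarrow> p \<in> polys Y"
  by (simp add: homogeneous_def)

lemma homogeneous_mult:
  "p \<in> homogeneous Y i \<Longrightarrow> q \<in> homogeneous Y j \<Longrightarrow> p * q \<in> homogeneous Y (i + j)"
  unfolding homogeneous_eq by (rule mons_in_mult) (auto simp: keys_add_nat mon_degree_add)

lemma homogeneous_zero [simp]: "0 \<in> homogeneous Y j" by (simp add: homogeneous_eq)
lemma homogeneous_one [simp]: "1 \<in> homogeneous Y 0"
  by (simp add: homogeneous_eq mons_in_def mon_degree_def)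
lemma homogeneous_add: "p \<in> homogeneous Y j \<Longrightarrow> q \<in> homogeneous Y j \<Longrightarrow> p + q \<in> homogeneous Y j"
  by (simp add: homogeneous_eq mons_in_add)
lemma homogeneous_uminus: "p \<in> homogeneous Y j \<Longrightarrow> - p \<in> homogeneous Y j"
  by (simp add: homogeneous_eq mons_in_uminus)

lemma homogeneous_neg: "p \<in> homogeneous Y j \<Longrightarrow> j < 0 \<Longrightarrow> p = 0"
  by (rule mons_in_disjoint[of p "{m. Poly_Mapping.keys m \<subseteq> Y \<and> int (mon_degree m) = j}" "{}"])
    (auto simp: homogeneous_eq mons_in_def)

lemma homogeneous_0_const:
  assumes "p \<in> homogeneous Y 0"
  obtains c where "p = Poly_Mapping.single 0 c"
proof
  show "p = Poly_Mapping.single 0 (Poly_Mapping.lookup p 0)"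
    using assms
    by (intro poly_mapping_eqI)
      (auto simp: homogeneous_def lookup_single when_def mon_degree_eq_0 in_keys_iff)
qed

lemma const_homogeneous: "Poly_Mapping.single 0 c \<in> homogeneous Y 0"
  by (simp add: homogeneous_eq mons_in_def mon_degree_def)

lemma homogeneous_0_inverse:
  assumes "p \<in> homogeneous Y 0" "p \<noteq> 0"
  obtains q where "q \<in> homogeneous Y 0" "q * p = 1"
proof -
  obtain c where c: "p = Poly_Mapping.single 0 c" using homogeneous_0_const[OF assms(1)] by auto
  have "c \<noteq> 0" using assms c by auto
  then have "Poly_Mapping.single 0 (inverse c) * p = 1"
    by (simp add: c mult_single)
  with that const_homogeneous show ?thesis by blast
qed

lemma irrelevant_eq: "irrelevant_ideal Y = mons_in {m. Poly_Mapping.keys m \<subseteq> Y \<and> m \<noteq> 0}"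
  by (auto simp: irrelevant_ideal_def poly_ring_def mons_in_def in_keys_iff)

lemma homogeneous_irrelevant: "p \<in> homogeneous Y j \<Longrightarrow> j \<noteq> 0 \<Longrightarrow> p \<in> irrelevant_ideal Y"
  by (auto simp: homogeneous_eq irrelevant_eq mons_in_def mon_degree_def)

lemma irrelevant_add: "p \<in> irrelevant_ideal Y \<Longrightarrow> q \<in> irrelevant_ideal Y \<Longrightarrow> p + q \<in> irrelevant_ideal Y"
  by (simp add: irrelevant_eq mons_in_add)

lemma irrelevant_zero: "0 \<in> irrelevant_ideal Y"
  by (simp add: irrelevant_eq)

lemma irrelevant_mult: "p \<in> irrelevant_ideal Y \<Longrightarrow> q \<in> polys Y \<Longrightarrow> p * q \<in> irrelevant_ideal Y"
  unfolding irrelevant_eq polys_eq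
  by (rule mons_in_mult)
    (auto simp: keys_add_nat mon_degree_add simp flip: mon_degree_eq_0)

lemma one_notin_irrelevant [simp]: "1 \<notin> irrelevant_ideal Y"
  by (simp add: irrelevant_ideal_def)

lemma irrelevant_homogeneous_0:
  "p \<in> irrelevant_ideal Y \<Longrightarrow> p \<in> homogeneous Y 0 \<Longrightarrow> p = 0"
  unfolding irrelevant_eq homogeneous_eq by (erule mons_in_disjoint) (auto simp: mon_degree_eq_0)

section \<open>Vectors of polynomials\<close>

definition smul :: "('v, 'k::field) mpoly \<Rightarrow> (nat \<Rightarrow> ('v, 'k) mpoly) \<Rightarrow> nat \<Rightarrow> ('v, 'k) mpoly"
    (infixr \<open>\<cdot>\<close> 75) where
  "p \<cdot> x = (\<lambda>b. p * x b)"

definition unit_vec :: "nat \<Rightarrow> nat \<Rightarrow> ('v, 'k::field) mpoly" where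
  "unit_vec i = (\<lambda>b. if b = i then 1 else 0)"

definition free_vecs :: "'v set \<Rightarrow> nat \<Rightarrow> (nat \<Rightarrow> ('v, 'k::field) mpoly) set" where
  "free_vecs Y n = {x. (\<forall>b<n. x b \<in> polys Y) \<and> (\<forall>b\<ge>n. x b = 0)}"

text \<open>
  All basis vectors have degree \<open>0\<close> here.  Twisted gradings enter only where resolutions are built or
  taken apart, which is possible because in a linear resolution each free module has all its twists
  equal.
\<close>

definition hom_vecs :: "'v set \<Rightarrow> int \<Rightarrow> (nat \<Rightarrow> ('v, 'k::field) mpoly) set" where
  "hom_vecs Y j = {x. \<forall>b. x b \<in> homogeneous Y j}"

text \<open>
  Of a list \<open>g\<close> of \<open>n\<close> vectors, encoded as a function, only the values below \<open>n\<close> matter.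
\<close>

definition comb ::
  "nat \<Rightarrow> (nat \<Rightarrow> nat \<Rightarrow> ('v, 'k::field) mpoly) \<Rightarrow> (nat \<Rightarrow> ('v, 'k) mpoly) \<Rightarrow> nat \<Rightarrow> ('v, 'k) mpoly" where
  "comb n g c = (\<Sum>i<n. c i \<cdot> g i)"

definition syz :: "'v set \<Rightarrow> nat \<Rightarrow> (nat \<Rightarrow> nat \<Rightarrow> ('v, 'k::field) mpoly) \<Rightarrow> (nat \<Rightarrow> ('v, 'k) mpoly) set" where
  "syz Y n g = {c \<in> free_vecs Y n. comb n g c = 0}"

definition submod :: "'v set \<Rightarrow> (nat \<Rightarrow> ('v, 'k::field) mpoly) set \<Rightarrow> bool" where
  "submod Y M \<longleftrightarrow> 0 \<in> M \<and> (\<forall>x\<in>M. \<forall>y\<in>M. x + y \<in> M) \<and> (\<forall>p\<in>polys Y. \<forall>x\<in>M. p \<cdot> x \<in> M)"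

definition lin_on :: "'v set \<Rightarrow> (nat \<Rightarrow> ('v, 'k::field) mpoly) set
    \<Rightarrow> ((nat \<Rightarrow> ('v, 'k) mpoly) \<Rightarrow> nat \<Rightarrow> ('v, 'k) mpoly) \<Rightarrow> bool" where
  "lin_on Y M \<phi> \<longleftrightarrow> (\<forall>x\<in>M. \<forall>y\<in>M. \<phi> (x + y) = \<phi> x + \<phi> y) \<and> (\<forall>p\<in>polys Y. \<forall>x\<in>M. \<phi> (p \<cdot> x) = p \<cdot> \<phi> x)"

lemma smul_apply [simp]: "(p \<cdot> x) b = p * x b" by (simp add: smul_def)
lemma smul_zero [simp]: "p \<cdot> 0 = 0" by (simp add: fun_eq_iff)
lemma zero_smul [simp]: "0 \<cdot> x = 0" by (simp add: fun_eq_iff)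
lemma one_smul [simp]: "1 \<cdot> x = x" by (simp add: fun_eq_iff)
lemma smul_smul: "p \<cdot> q \<cdot> x = (p * q) \<cdot> x" by (simp add: fun_eq_iff mult.assoc)
lemma smul_add: "p \<cdot> (x + y) = p \<cdot> x + p \<cdot> y" by (simp add: fun_eq_iff distrib_left)
lemma add_smul: "(p + q) \<cdot> x = p \<cdot> x + q \<cdot> x" by (simp add: fun_eq_iff distrib_right)
lemma uminus_smul: "(- p) \<cdot> x = - (p \<cdot> x)" by (simp add: fun_eq_iff)

lemma sum_apply: "(\<Sum>i\<in>I. f i) b = (\<Sum>i\<in>I. f i b)" for f :: "'i \<Rightarrow> nat \<Rightarrow> ('v, 'k::field) mpoly"
  by (induction I rule: infinite_finite_induct) auto

lemma submod_zero: "submod Y M \<Longrightarrow> 0 \<in> M" by (simp add: submod_def)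
lemma submod_add: "submod Y M \<Longrightarrow> x \<in> M \<Longrightarrow> y \<in> M \<Longrightarrow> x + y \<in> M" by (simp add: submod_def)
lemma submod_smul: "submod Y M \<Longrightarrow> p \<in> polys Y \<Longrightarrow> x \<in> M \<Longrightarrow> p \<cdot> x \<in> M" by (simp add: submod_def)
lemma submod_uminus: "submod Y M \<Longrightarrow> x \<in> M \<Longrightarrow> - x \<in> M"
  using submod_smul[of Y M "- 1" x] by (simp add: uminus_smul polys_uminus)
lemma submod_diff: "submod Y M \<Longrightarrow> x \<in> M \<Longrightarrow> y \<in> M \<Longrightarrow> x - y \<in> M"
  using submod_add[of Y M x "- y"] by (simp add: submod_uminus)
lemma submod_sum: "submod Y M \<Longrightarrow> (\<And>i. i \<in> I \<Longrightarrow> f i \<in> M) \<Longrightarrow> sum f I \<in> M"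
  by (induction I rule: infinite_finite_induct) (auto simp: submod_zero submod_add)

lemma lin_on_add: "lin_on Y M \<phi> \<Longrightarrow> x \<in> M \<Longrightarrow> y \<in> M \<Longrightarrow> \<phi> (x + y) = \<phi> x + \<phi> y"
  by (simp add: lin_on_def)
lemma lin_on_smul: "lin_on Y M \<phi> \<Longrightarrow> p \<in> polys Y \<Longrightarrow> x \<in> M \<Longrightarrow> \<phi> (p \<cdot> x) = p \<cdot> \<phi> x"
  by (simp add: lin_on_def)
lemma lin_on_zero: "lin_on Y M \<phi> \<Longrightarrow> submod Y M \<Longrightarrow> \<phi> 0 = 0"
  using lin_on_smul[of Y M \<phi> 0 0] by (simp add: submod_zero)
lemma lin_on_uminus: "lin_on Y M \<phi> \<Longrightarrow> x \<in> M \<Longrightarrow> \<phi> (- x) = - \<phi> x"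
  using lin_on_smul[of Y M \<phi> "- 1" x] by (simp add: uminus_smul polys_uminus)
lemma lin_on_diff: "lin_on Y M \<phi> \<Longrightarrow> submod Y M \<Longrightarrow> x \<in> M \<Longrightarrow> y \<in> M \<Longrightarrow> \<phi> (x - y) = \<phi> x - \<phi> y"
proof -
  assume *: "lin_on Y M \<phi>" "submod Y M" "x \<in> M" "y \<in> M"
  have "\<phi> (x + - y) = \<phi> x + \<phi> (- y)"
    by (rule lin_on_add[OF *(1,3) submod_uminus[OF *(2,4)]])
  also have "\<phi> (- y) = - \<phi> y"
    by (rule lin_on_uminus[OF *(1,4)])
  finally have "\<phi> (x + - y) = \<phi> x + - \<phi> y" .
  then show ?thesis by simp
qed
lemma lin_on_sum:
  assumes "lin_on Y M \<phi>" "submod Y M" "\<And>i. i \<in> I \<Longrightarrow> f i \<in> M"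
  shows "\<phi> (sum f I) = (\<Sum>i\<in>I. \<phi> (f i))"
  using assms(3)
proof (induction I rule: infinite_finite_induct)
  case (insert i I)
  have "\<phi> (f i + sum f I) = \<phi> (f i) + \<phi> (sum f I)"
    using insert.prems by (intro lin_on_add[OF assms(1)] submod_sum[OF assms(2)]) auto
  moreover have "\<phi> (sum f I) = (\<Sum>i\<in>I. \<phi> (f i))"
    using insert.prems by (intro insert.IH) auto
  ultimately show ?case
    by (simp only: sum.insert[OF insert.hyps(1,2)])
qed (auto simp: lin_on_zero[OF assms(1,2)])

lemma free_vecs_polys: "c \<in> free_vecs Y n \<Longrightarrow> c i \<in> polys Y"
  by (cases "i < n") (auto simp: free_vecs_def)

lemma submod_free: "submod Y (free_vecs Y n)"
  by (auto simp: submod_def free_vecs_def)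

lemma unit_vec_free: "i < n \<Longrightarrow> unit_vec i \<in> free_vecs Y n"
  by (auto simp: unit_vec_def free_vecs_def)

lemma unit_vec_hom: "unit_vec i \<in> hom_vecs Y 0"
  by (auto simp: unit_vec_def hom_vecs_def)

lemma hom_vecs_zero [simp]: "0 \<in> hom_vecs Y j" by (simp add: hom_vecs_def)
lemma hom_vecs_add: "x \<in> hom_vecs Y j \<Longrightarrow> y \<in> hom_vecs Y j \<Longrightarrow> x + y \<in> hom_vecs Y j"
  by (auto simp: hom_vecs_def homogeneous_add)
lemma hom_vecs_uminus: "x \<in> hom_vecs Y j \<Longrightarrow> - x \<in> hom_vecs Y j"
  by (auto simp: hom_vecs_def homogeneous_uminus)
lemma hom_vecs_diff: "x \<in> hom_vecs Y j \<Longrightarrow> y \<in> hom_vecs Y j \<Longrightarrow> x - y \<in> hom_vecs Y j"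
  using hom_vecs_add[of x Y j "- y"] by (simp add: hom_vecs_uminus)
lemma hom_vecs_smul: "p \<in> homogeneous Y i \<Longrightarrow> x \<in> hom_vecs Y j \<Longrightarrow> p \<cdot> x \<in> hom_vecs Y (i + j)"
  by (auto simp: hom_vecs_def homogeneous_mult)
lemma hom_vecs_sum: "(\<And>i. i \<in> I \<Longrightarrow> f i \<in> hom_vecs Y j) \<Longrightarrow> sum f I \<in> hom_vecs Y j"
  by (induction I rule: infinite_finite_induct) (auto simp: hom_vecs_add)

lemma comb_mem: "submod Y M \<Longrightarrow> (\<And>i. i < n \<Longrightarrow> g i \<in> M) \<Longrightarrow> c \<in> free_vecs Y n \<Longrightarrow> comb n g c \<in> M"
  unfolding comb_def by (rule submod_sum) (auto intro: submod_smul free_vecs_polys)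

lemma comb_add: "comb n g (x + y) = comb n g x + comb n g y"
  by (simp add: comb_def add_smul sum.distrib)

lemma comb_smul: "comb n g (p \<cdot> x) = p \<cdot> comb n g x"
  by (simp add: comb_def fun_eq_iff sum_apply sum_distrib_left mult.assoc)

lemma comb_lin: "lin_on Y M (comb n g)"
  by (simp add: lin_on_def comb_add comb_smul)

lemma comb_zero [simp]: "comb n g 0 = 0"
  by (simp add: comb_def)

lemma comb_diff: "comb n g (x - y) = comb n g x - comb n g y"
  using comb_add[of n g "x - y" y] by simp

lemma comb_cong: "(\<And>i. i < n \<Longrightarrow> g i = g' i) \<Longrightarrow> (\<And>i. i < n \<Longrightarrow> c i = c' i) \<Longrightarrow> comb n g c = comb n g' c'"
  by (simp add: comb_def)

lemma comb_Suc: "comb (Suc n) g c = comb n g c + c n \<cdot> g n"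
  by (simp add: comb_def)

lemma comb_unit_vec: "i < n \<Longrightarrow> comb n g (unit_vec i) = g i"
proof -
  assume i: "i < n"
  have "comb n g (unit_vec i) = (\<Sum>j<n. if j = i then g i else 0)"
    unfolding comb_def by (rule sum.cong) (auto simp: unit_vec_def)
  then show ?thesis using i by simp
qed

lemma comb_unit_vecs: "c \<in> free_vecs Y n \<Longrightarrow> comb n unit_vec c = c"
  by (auto simp: comb_def fun_eq_iff sum_apply unit_vec_def free_vecs_def if_distrib[of "\<lambda>x. _ * x"] cong: if_cong)

lemma comb_hom: "(\<And>i. i < n \<Longrightarrow> g i \<in> hom_vecs Y q) \<Longrightarrow> c \<in> hom_vecs Y j \<Longrightarrow> comb n g c \<in> hom_vecs Y (q + j)"
  unfolding comb_def
proof (rule hom_vecs_sum)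
  fix i assume "\<And>i. i < n \<Longrightarrow> g i \<in> hom_vecs Y q" "c \<in> hom_vecs Y j" "i \<in> {..<n}"
  then show "c i \<cdot> g i \<in> hom_vecs Y (q + j)"
    using hom_vecs_smul[of "c i" Y j "g i" q] by (auto simp: hom_vecs_def add.commute)
qed

lemma lin_on_comb:
  assumes "lin_on Y M \<phi>" "submod Y M" "\<And>i. i < n \<Longrightarrow> g i \<in> M" "c \<in> free_vecs Y n"
  shows "\<phi> (comb n g c) = comb n (\<lambda>i. \<phi> (g i)) c"
proof -
  have "\<phi> (comb n g c) = (\<Sum>i<n. \<phi> (c i \<cdot> g i))"
    unfolding comb_def
    by (rule lin_on_sum[OF assms(1,2)])
      (auto intro!: submod_smul[OF assms(2)] assms(3) free_vecs_polys[OF assms(4)])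
  also have "\<dots> = comb n (\<lambda>i. \<phi> (g i)) c"
    unfolding comb_def
    by (rule sum.cong) (auto intro!: lin_on_smul[OF assms(1)] assms(3) free_vecs_polys[OF assms(4)])
  finally show ?thesis .
qed

lemma submod_comb_image: "submod Y (comb n g ` free_vecs Y n)"
proof -
  have "0 \<in> comb n g ` free_vecs Y n"
    by (rule image_eqI[of _ _ 0]) (auto intro: submod_zero[OF submod_free])
  moreover have "x + y \<in> comb n g ` free_vecs Y n"
    if "x \<in> comb n g ` free_vecs Y n" "y \<in> comb n g ` free_vecs Y n" for x y
    using that by (auto simp flip: comb_add intro: submod_add[OF submod_free])
  moreover have "p \<cdot> x \<in> comb n g ` free_vecs Y n"
    if "x \<in> comb n g ` free_vecs Y n" "p \<in> polys Y" for p x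
    using that by (auto simp flip: comb_smul intro: submod_smul[OF submod_free])
  ultimately show ?thesis by (simp add: submod_def)
qed

lemma gen_mem: "i < n \<Longrightarrow> g i \<in> comb n g ` free_vecs Y n"
  by (metis comb_unit_vec image_eqI unit_vec_free)

lemma submod_kernel: "submod Y M \<Longrightarrow> lin_on Y M \<phi> \<Longrightarrow> submod Y {x \<in> M. \<phi> x = 0}"
  using lin_on_zero[of Y M \<phi>]
  by (auto simp: submod_def lin_on_def)

lemma submod_syz: "submod Y (syz Y n g)"
  unfolding syz_def by (rule submod_kernel[OF submod_free comb_lin])

text \<open>
  The coefficients of a homogeneous combination of homogeneous vectors of the same degree can be
  taken homogeneous: the other homogeneous parts of the coefficients contribute only monomials of
  other degrees, so their contributions cancel.
\<close>

lemma lift_homogeneous: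
  assumes g: "\<And>i. i < n \<Longrightarrow> g i \<in> hom_vecs Y q"
    and c: "c \<in> free_vecs Y n" and h: "comb n g c \<in> hom_vecs Y (q + j)"
  obtains c' where "c' \<in> free_vecs Y n" "c' \<in> hom_vecs Y j" "comb n g c' = comb n g c"
proof -
  let ?H = "{m. Poly_Mapping.keys m \<subseteq> Y \<and> int (mon_degree m) = j}"
  let ?N = "{m. Poly_Mapping.keys m \<subseteq> Y} - ?H"
  have "\<forall>i. \<exists>a. a \<in> mons_in ?H \<and> (\<exists>r. r \<in> mons_in ?N \<and> c i = a + r)"
  proof
    fix i
    have "c i \<in> mons_in (?H \<union> {m. Poly_Mapping.keys m \<subseteq> Y})"
      using free_vecs_polys[OF c, of i] by (auto simp: polys_eq mons_in_def)
    then obtain a r where "a \<in> mons_in ?H" "r \<in> mons_in ?N" "c i = a + r"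
      by (rule mons_in_split)
    then show "\<exists>a. a \<in> mons_in ?H \<and> (\<exists>r. r \<in> mons_in ?N \<and> c i = a + r)" by blast
  qed
  then obtain a where "\<forall>i. a i \<in> mons_in ?H \<and> (\<exists>r. r \<in> mons_in ?N \<and> c i = a i + r)"
    by (rule choice[THEN exE])
  then have ar1: "\<And>i. a i \<in> mons_in ?H" and "\<forall>i. \<exists>r. r \<in> mons_in ?N \<and> c i = a i + r"
    by auto
  from this(2) obtain r where "\<forall>i. r i \<in> mons_in ?N \<and> c i = a i + r i"
    by (rule choice[THEN exE])
  with ar1 have ar: "\<And>i. a i \<in> mons_in ?H" "\<And>i. r i \<in> mons_in ?N" "\<And>i. c i = a i + r i"
    by auto
  define a' where "a' = (\<lambda>i. if i < n then a i else 0)"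
  have a': "a' \<in> hom_vecs Y j" "a' \<in> free_vecs Y n"
    using ar(1)
    by (auto simp: a'_def hom_vecs_def free_vecs_def homogeneous_eq intro!: homogeneous_polys[of _ Y j])
  have "comb n g c = comb n g (a + r)"
    by (rule comb_cong) (auto simp: ar(3))
  also have "\<dots> = comb n g a' + comb n g r"
    unfolding comb_add by (simp add: a'_def cong: comb_cong)
  finally have eq: "comb n g r = comb n g c - comb n g a'" by simp
  have H: "comb n g r \<in> hom_vecs Y (q + j)"
    unfolding eq by (rule hom_vecs_diff[OF h comb_hom[OF g a'(1)]])
  have "comb n g r b = 0" for b
  proof (rule mons_in_disjoint)
    show "comb n g r b \<in> mons_in {m. Poly_Mapping.keys m \<subseteq> Y \<and> int (mon_degree m) = q + j}"
      using H by (simp add: hom_vecs_def homogeneous_eq)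
    have t: "r i * g i b \<in> mons_in {m. int (mon_degree m) \<noteq> q + j}" if "i < n" for i
    proof (rule mons_in_mult[OF ar(2)])
      show "g i b \<in> mons_in {m. Poly_Mapping.keys m \<subseteq> Y \<and> int (mon_degree m) = q}"
        using g[OF that] by (simp add: hom_vecs_def homogeneous_eq)
    qed (auto simp: mon_degree_add)
    have "(\<Sum>i\<in>I. r i * g i b) \<in> mons_in {m. int (mon_degree m) \<noteq> q + j}" if "I \<subseteq> {..<n}" for I
      using that by (induction I rule: infinite_finite_induct) (auto intro!: mons_in_add t)
    then show "comb n g r b \<in> mons_in {m. int (mon_degree m) \<noteq> q + j}"
      by (simp add: comb_def sum_apply)
  qed auto
  then have "comb n g a' = comb n g c"
    using eq by (simp add: fun_eq_iff)
  with a' show ?thesis using that by blast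
qed

lemma hom_vecs_neg: "x \<in> hom_vecs Y j \<Longrightarrow> j < 0 \<Longrightarrow> x = 0"
  by (auto simp: hom_vecs_def fun_eq_iff dest: homogeneous_neg)

lemma comb_below_degree:
  assumes "\<And>i. i < n \<Longrightarrow> g i \<in> hom_vecs Y q" "x \<in> comb n g ` free_vecs Y n" "x \<in> hom_vecs Y j" "j < q"
  shows "x = 0"
proof -
  obtain c where c: "c \<in> free_vecs Y n" "x = comb n g c" using assms(2) by blast
  have h: "comb n g c \<in> hom_vecs Y (q + (j - q))" using c assms(3) by simp
  obtain c' where "c' \<in> hom_vecs Y (j - q)" "comb n g c' = comb n g c"
    using lift_homogeneous[OF assms(1) c(1) h] by blast
  then show ?thesis using hom_vecs_neg[of c' Y "j - q"] assms(4) c by auto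
qed

section \<open>Modules with a linear resolution\<close>

text \<open>
  A module is linear in degree \<open>q\<close> if it is generated by finitely many vectors of degree \<open>q\<close>, the
  relations between these are generated by finitely many relations with linear coefficients, the
  relations between the latter likewise, and so on.  Relation modules are submodules of a free
  module whose basis vectors have degree \<open>0\<close>, so a relation with linear coefficients has degree
  \<open>1\<close>, whatever \<open>q\<close> is.  Minimality is automatic: a relation module that is linear in degree \<open>1\<close>
  contains no non-zero relation with constant coefficients.
\<close>

coinductive linear_module :: "'v set \<Rightarrow> int \<Rightarrow> (nat \<Rightarrow> ('v, 'k::field) mpoly) set \<Rightarrow> bool" for Y where
  linear_moduleI: "\<lbrakk>\<And>i. i < n \<Longrightarrow> g i \<in> hom_vecs Y q; linear_module Y 1 (syz Y n g)\<rbrakk>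
    \<Longrightarrow> linear_module Y q (comb n g ` free_vecs Y n)"

lemma linear_moduleE:
  assumes "linear_module Y q M"
  obtains n g where "\<And>i. i < n \<Longrightarrow> g i \<in> hom_vecs Y q" "M = comb n g ` free_vecs Y n"
    "linear_module Y 1 (syz Y n g)"
  using assms by (cases rule: linear_module.cases) auto

lemma linear_submod: "linear_module Y q M \<Longrightarrow> submod Y M"
  by (metis linear_moduleE submod_comb_image)

lemma linear_below_degree:
  "linear_module Y q M \<Longrightarrow> x \<in> M \<Longrightarrow> x \<in> hom_vecs Y j \<Longrightarrow> j < q \<Longrightarrow> x = 0"
  by (metis linear_moduleE comb_below_degree)

lemma syz_comp:
  assumes "lin_on Y M \<phi>" "submod Y M" "\<forall>i<n. g i \<in> M"
  shows "syz Y n (\<lambda>i. \<phi> (g i)) = {c \<in> free_vecs Y n. \<phi> (comb n g c) = 0}"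
    and "comb n (\<lambda>i. \<phi> (g i)) ` free_vecs Y n = \<phi> ` comb n g ` free_vecs Y n"
proof -
  have *: "\<phi> (comb n g c) = comb n (\<lambda>i. \<phi> (g i)) c" if "c \<in> free_vecs Y n" for c
    using assms(3) by (intro lin_on_comb[OF assms(1,2) _ that]) auto
  show "syz Y n (\<lambda>i. \<phi> (g i)) = {c \<in> free_vecs Y n. \<phi> (comb n g c) = 0}"
    unfolding syz_def using * by auto
  show "comb n (\<lambda>i. \<phi> (g i)) ` free_vecs Y n = \<phi> ` comb n g ` free_vecs Y n"
    unfolding image_image by (rule image_cong) (simp_all add: *)
qed

text \<open>
  The images of a list of generators satisfy the same relations as the generators, so the two
  modules have the same resolution from the first relation module on.
\<close>

lemma linear_iso:
  assumes M: "linear_module Y q M" and \<phi>: "lin_on Y M \<phi>"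
    and inj: "\<And>x. x \<in> M \<Longrightarrow> \<phi> x = 0 \<Longrightarrow> x = 0"
    and hom: "\<And>x. x \<in> M \<Longrightarrow> x \<in> hom_vecs Y q \<Longrightarrow> \<phi> x \<in> hom_vecs Y q'"
  shows "linear_module Y q' (\<phi> ` M)"
proof -
  obtain n g where g: "\<And>i. i < n \<Longrightarrow> g i \<in> hom_vecs Y q" "M = comb n g ` free_vecs Y n"
    "linear_module Y 1 (syz Y n g)"
    using M by (rule linear_moduleE) blast
  have gM: "\<forall>i<n. g i \<in> M"
    unfolding g(2) using gen_mem by blast
  note s = syz_comp[OF \<phi> linear_submod[OF M] gM]
  have 0: "\<phi> 0 = 0" by (rule lin_on_zero[OF \<phi> linear_submod[OF M]])
  have "syz Y n (\<lambda>i. \<phi> (g i)) = syz Y n g"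
    unfolding s(1) unfolding syz_def using inj 0 g(2) by auto
  then show ?thesis
    using linear_moduleI[of n "\<lambda>i. \<phi> (g i)" Y q'] g(3) hom gM g(1) unfolding g(2) s(2) by simp
qed

section \<open>Concatenated lists of generators\<close>

text \<open>
  If \<open>A\<close> is a submodule of \<open>B\<close>, generators of \<open>A\<close> followed by lifts of generators of \<open>B / A\<close>
  generate \<open>B\<close>.  The two parts of a coefficient vector for such a list are split off by \<open>fst_part\<close>
  and \<open>snd_part\<close>.
\<close>

definition cat :: "nat \<Rightarrow> (nat \<Rightarrow> 'a) \<Rightarrow> (nat \<Rightarrow> 'a) \<Rightarrow> nat \<Rightarrow> 'a" where
  "cat m u w = (\<lambda>i. if i < m then u i else w (i - m))"

definition fst_part :: "nat \<Rightarrow> (nat \<Rightarrow> ('v, 'k::field) mpoly) \<Rightarrow> nat \<Rightarrow> ('v, 'k) mpoly" where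
  "fst_part m c = (\<lambda>i. if i < m then c i else 0)"

definition snd_part :: "nat \<Rightarrow> (nat \<Rightarrow> ('v, 'k::field) mpoly) \<Rightarrow> nat \<Rightarrow> ('v, 'k) mpoly" where
  "snd_part m c = (\<lambda>i. c (m + i))"

lemma comb_cat:
  "comb (m + n) (cat m u w) c = comb m u (fst_part m c) + comb n w (snd_part m c)"
proof (induction n)
  case 0
  have "comb m (cat m u w) c = comb m u (fst_part m c)"
    by (rule comb_cong) (auto simp: cat_def fst_part_def)
  then show ?case by (simp add: comb_def)
next
  case (Suc n)
  then show ?case by (simp add: comb_Suc cat_def snd_part_def add.assoc)
qed

lemma fst_part_free: "c \<in> free_vecs Y (m + n) \<Longrightarrow> fst_part m c \<in> free_vecs Y m"
  by (auto simp: fst_part_def free_vecs_def)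
lemma free_vecs_mono: "c \<in> free_vecs Y m \<Longrightarrow> m \<le> n \<Longrightarrow> c \<in> free_vecs Y n"
  using free_vecs_polys[of c Y m] by (auto simp: free_vecs_def)
lemma snd_part_free: "c \<in> free_vecs Y (m + n) \<Longrightarrow> snd_part m c \<in> free_vecs Y n"
  by (auto simp: snd_part_def free_vecs_def)
lemma cat_free: "a \<in> free_vecs Y m \<Longrightarrow> b \<in> free_vecs Y n \<Longrightarrow> cat m a b \<in> free_vecs Y (m + n)"
  by (auto simp: cat_def free_vecs_def)
lemma fst_part_cat: "a \<in> free_vecs Y m \<Longrightarrow> fst_part m (cat m a b) = a"
  by (auto simp: fst_part_def cat_def free_vecs_def)
lemma snd_part_cat: "snd_part m (cat m a b) = b"
  by (auto simp: snd_part_def cat_def)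
lemma fst_part_self: "a \<in> free_vecs Y m \<Longrightarrow> fst_part m a = a"
  by (auto simp: fst_part_def free_vecs_def)
lemma cat_parts: "cat m (fst_part m c) (snd_part m c) = c"
  by (auto simp: fst_part_def snd_part_def cat_def)
lemma parts_zero:
  assumes "fst_part m c = 0" "snd_part m c = 0"
  shows "c = 0"
proof -
  have "c = cat m 0 0" using cat_parts[of m c] unfolding assms by simp
  then show ?thesis by (simp add: cat_def fun_eq_iff)
qed
lemma cat_zero: "a \<in> free_vecs Y m \<Longrightarrow> cat m a 0 = a"
  by (auto simp: cat_def free_vecs_def)
lemma fst_part_hom: "c \<in> hom_vecs Y j \<Longrightarrow> fst_part m c \<in> hom_vecs Y j"
  by (auto simp: fst_part_def hom_vecs_def)
lemma snd_part_hom: "c \<in> hom_vecs Y j \<Longrightarrow> snd_part m c \<in> hom_vecs Y j"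
  by (auto simp: snd_part_def hom_vecs_def)
lemma cat_hom: "a \<in> hom_vecs Y j \<Longrightarrow> b \<in> hom_vecs Y j \<Longrightarrow> cat m a b \<in> hom_vecs Y j"
  by (auto simp: cat_def hom_vecs_def)
lemma fst_part_lin: "lin_on Y M (fst_part m)"
  by (auto simp: lin_on_def fst_part_def fun_eq_iff)
lemma snd_part_lin: "lin_on Y M (snd_part m)"
  by (auto simp: lin_on_def snd_part_def fun_eq_iff)

lemma comb_cat_image:
  "comb (m + n) (cat m u w) ` free_vecs Y (m + n) =
    {x + y | x y. x \<in> comb m u ` free_vecs Y m \<and> y \<in> comb n w ` free_vecs Y n}" (is "?L = ?R")
proof
  show "?L \<subseteq> ?R"
    by (auto simp: comb_cat intro: fst_part_free snd_part_free)
  show "?R \<subseteq> ?L"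
  proof
    fix z assume "z \<in> ?R"
    then obtain a b where ab: "a \<in> free_vecs Y m" "b \<in> free_vecs Y n" "z = comb m u a + comb n w b"
      by auto
    then have "z = comb (m + n) (cat m u w) (cat m a b)"
      by (simp only: comb_cat fst_part_cat[OF ab(1)] snd_part_cat)
    with cat_free[OF ab(1,2)] show "z \<in> ?L" by blast
  qed
qed

section \<open>Extensions and quotients\<close>

text \<open>
  This is the horseshoe lemma for the exact sequence of the kernel of \<open>\<beta>\<close>, of \<open>B\<close> and of its
  image.  Lift generators of the image to \<open>B\<close> and put generators of the kernel in front.  The
  relations between all of these project onto the relations in the image, and the kernel of this
  projection consists of the relations in the kernel of \<open>\<beta>\<close>: the situation has reproduced itself
  one step further, which is what coinduction asks for.  The map \<open>\<beta>\<close> may shift degrees; it only has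
  to be surjective from degree \<open>q\<close> to degree \<open>q'\<close>.
\<close>

lemma linear_extension:
  fixes B :: "(nat \<Rightarrow> ('v, 'k::field) mpoly) set"
  assumes "submod Y B" "lin_on Y B \<beta>"
    and "\<And>c. c \<in> \<beta> ` B \<Longrightarrow> c \<in> hom_vecs Y q' \<Longrightarrow> \<exists>b\<in>B. b \<in> hom_vecs Y q \<and> \<beta> b = c"
    and "linear_module Y q {b \<in> B. \<beta> b = 0}" "linear_module Y q' (\<beta> ` B)"
  shows "linear_module Y q B"
proof -
  define P where "P = (\<lambda>q (B :: (nat \<Rightarrow> ('v, 'k) mpoly) set). \<exists>\<beta> q'. submod Y B \<and> lin_on Y B \<beta> \<and>
    (\<forall>c\<in>\<beta> ` B. c \<in> hom_vecs Y q' \<longrightarrow> (\<exists>b\<in>B. b \<in> hom_vecs Y q \<and> \<beta> b = c)) \<and>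
    linear_module Y q {b \<in> B. \<beta> b = 0} \<and> linear_module Y q' (\<beta> ` B))"
  have "P q B" unfolding P_def using assms by blast
  then show ?thesis
  proof (coinduction arbitrary: q B)
    case (linear_module q B)
    then obtain \<beta> q' where B: "submod Y B" "lin_on Y B \<beta>"
      and lift: "\<And>c. c \<in> \<beta> ` B \<Longrightarrow> c \<in> hom_vecs Y q' \<Longrightarrow> \<exists>b\<in>B. b \<in> hom_vecs Y q \<and> \<beta> b = c"
      and A: "linear_module Y q {b \<in> B. \<beta> b = 0}" and C: "linear_module Y q' (\<beta> ` B)"
      unfolding P_def by blast
    obtain m g where g: "\<And>i. i < m \<Longrightarrow> g i \<in> hom_vecs Y q"
        "{b \<in> B. \<beta> b = 0} = comb m g ` free_vecs Y m" "linear_module Y 1 (syz Y m g)"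
      using A by (rule linear_moduleE) blast
    obtain n h where h: "\<And>i. i < n \<Longrightarrow> h i \<in> hom_vecs Y q'"
        "\<beta> ` B = comb n h ` free_vecs Y n" "linear_module Y 1 (syz Y n h)"
      using C by (rule linear_moduleE) blast
    have "\<exists>b. b \<in> B \<and> b \<in> hom_vecs Y q \<and> \<beta> b = h i" if "i < n" for i
    proof -
      have "h i \<in> \<beta> ` B" unfolding h(2) using that by (rule gen_mem)
      from lift[OF this h(1)[OF that]] show ?thesis by blast
    qed
    then obtain h' where h': "\<And>i. i < n \<Longrightarrow> h' i \<in> B" "\<And>i. i < n \<Longrightarrow> h' i \<in> hom_vecs Y q"
        "\<And>i. i < n \<Longrightarrow> \<beta> (h' i) = h i"
      by metis
    have gB: "g i \<in> B" "\<beta> (g i) = 0" if "i < m" for i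
      using gen_mem[OF that, of g Y] g(2) by blast+
    have Bh': "comb n h' b \<in> B" if "b \<in> free_vecs Y n" for b
      by (rule comb_mem[OF B(1) h'(1) that])
    have \<beta>h': "\<beta> (comb n h' b) = comb n h b" if "b \<in> free_vecs Y n" for b
    proof -
      have "\<beta> (comb n h' b) = comb n (\<lambda>i. \<beta> (h' i)) b"
        by (rule lin_on_comb[OF B(2,1) h'(1) that])
      also have "\<dots> = comb n h b" by (rule comb_cong) (simp_all add: h'(3))
      finally show ?thesis .
    qed
    have gA: "comb m g a \<in> B" "\<beta> (comb m g a) = 0" if "a \<in> free_vecs Y m" for a
      using g(2) that by blast+
    let ?G = "cat m g h'"
    have "?G i \<in> hom_vecs Y q" if "i < m + n" for i
      using that g(1) h'(2) by (auto simp: cat_def)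
    moreover have "B = comb (m + n) ?G ` free_vecs Y (m + n)"
    proof
      show "comb (m + n) ?G ` free_vecs Y (m + n) \<subseteq> B"
        unfolding comb_cat_image using gA(1) Bh' submod_add[OF B(1)] by auto
      show "B \<subseteq> comb (m + n) ?G ` free_vecs Y (m + n)"
      proof
        fix x assume x: "x \<in> B"
        then obtain b where b: "b \<in> free_vecs Y n" "\<beta> x = comb n h b"
          using h(2) by blast
        have "\<beta> (x - comb n h' b) = \<beta> x - \<beta> (comb n h' b)"
          by (rule lin_on_diff[OF B(2,1) x Bh'[OF b(1)]])
        then have "\<beta> (x - comb n h' b) = 0" using \<beta>h'[OF b(1)] b(2) by simp
        moreover have "x - comb n h' b \<in> B" by (rule submod_diff[OF B(1) x Bh'[OF b(1)]])
        ultimately have "x - comb n h' b \<in> comb m g ` free_vecs Y m" using g(2) by blast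
        moreover have "x = (x - comb n h' b) + comb n h' b" by simp
        ultimately show "x \<in> comb (m + n) ?G ` free_vecs Y (m + n)"
          unfolding comb_cat_image using b(1) by blast
      qed
    qed
    moreover have "P 1 (syz Y (m + n) ?G)"
    proof -
      let ?K = "syz Y (m + n) ?G"
      have ker: "{c \<in> ?K. snd_part m c = 0} = syz Y m g" (is "?L = _")
      proof
        show "?L \<subseteq> syz Y m g"
        proof
          fix c assume c: "c \<in> ?L"
          then have f: "c \<in> free_vecs Y (m + n)" by (simp add: syz_def)
          have "c = cat m (fst_part m c) 0" using cat_parts[of m c] c by auto
          also have "\<dots> = fst_part m c" by (rule cat_zero[OF fst_part_free[OF f]])
          finally have "c = fst_part m c" .
          then show "c \<in> syz Y m g"
            using c fst_part_free[OF f] by (auto simp: syz_def comb_cat)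
        qed
        show "syz Y m g \<subseteq> ?L"
        proof
          fix c assume c: "c \<in> syz Y m g"
          then have f: "c \<in> free_vecs Y m" and c0: "comb m g c = 0" by (auto simp: syz_def)
          have "c \<in> free_vecs Y (m + n)" by (rule free_vecs_mono[OF f]) simp
          moreover have "snd_part m c = 0" using f by (auto simp: snd_part_def free_vecs_def fun_eq_iff)
          ultimately show "c \<in> ?L"
            using c0 fst_part_self[OF f] by (auto simp: syz_def comb_cat)
        qed
      qed
      have lift': "\<exists>c\<in>?K. snd_part m c = b \<and> (b \<in> hom_vecs Y 1 \<longrightarrow> c \<in> hom_vecs Y 1)"
        if b: "b \<in> syz Y n h" for b
      proof -
        have f: "b \<in> free_vecs Y n" and b0: "comb n h b = 0" using b by (auto simp: syz_def)
        \<comment> \<open>A relation between the generators of the image, applied to the lifts, gives an element of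
          the kernel; subtracting its expression by generators of the kernel lifts the relation.\<close>
        have "comb n h' b \<in> {b \<in> B. \<beta> b = 0}" using \<beta>h'[OF f] Bh'[OF f] b0 by auto
        then obtain a where a: "a \<in> free_vecs Y m" "comb n h' b = comb m g a" using g(2) by blast
        have "\<exists>a'\<in>free_vecs Y m. comb m g a' = comb m g a \<and> (b \<in> hom_vecs Y 1 \<longrightarrow> a' \<in> hom_vecs Y 1)"
        proof (cases "b \<in> hom_vecs Y 1")
          case True
          have "comb n h' b \<in> hom_vecs Y (q + 1)" by (rule comb_hom[OF h'(2) True])
          then have "comb m g a \<in> hom_vecs Y (q + 1)" using a by simp
          from lift_homogeneous[OF g(1) a(1) this] show ?thesis by metis
        qed (use a in blast)
        then obtain a' where a': "a' \<in> free_vecs Y m" "comb m g a' = comb m g a"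
          "b \<in> hom_vecs Y 1 \<longrightarrow> a' \<in> hom_vecs Y 1" by blast
        let ?c = "cat m (- a') b"
        have ma': "- a' \<in> free_vecs Y m" by (rule submod_uminus[OF submod_free a'(1)])
        have "comb m g (- a') = - comb m g a'" using comb_diff[of m g 0 a'] by simp
        then have "comb (m + n) ?G ?c = 0"
          using a(2) a'(2) by (simp add: comb_cat fst_part_cat[OF ma'] snd_part_cat)
        then have "?c \<in> ?K" using cat_free[OF ma' f] by (simp add: syz_def)
        moreover have "b \<in> hom_vecs Y 1 \<longrightarrow> ?c \<in> hom_vecs Y 1"
          using a'(3) by (auto intro: cat_hom hom_vecs_uminus)
        ultimately show ?thesis using snd_part_cat by blast
      qed
      have img: "snd_part m ` ?K = syz Y n h"
      proof
        show "syz Y n h \<subseteq> snd_part m ` ?K" using lift' by blast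
        show "snd_part m ` ?K \<subseteq> syz Y n h"
        proof
          fix b assume "b \<in> snd_part m ` ?K"
          then obtain c where c: "c \<in> free_vecs Y (m + n)" "comb (m + n) ?G c = 0" "b = snd_part m c"
            by (auto simp: syz_def)
          note f = fst_part_free[OF c(1)] snd_part_free[OF c(1)]
          have "\<beta> (comb m g (fst_part m c) + comb n h' (snd_part m c)) =
              \<beta> (comb m g (fst_part m c)) + \<beta> (comb n h' (snd_part m c))"
            by (rule lin_on_add[OF B(2) gA(1)[OF f(1)] Bh'[OF f(2)]])
          moreover have "\<beta> 0 = 0" by (rule lin_on_zero[OF B(2,1)])
          ultimately have "comb n h b = 0"
            using c(2,3) gA(2)[OF f(1)] \<beta>h'[OF f(2)] by (simp add: comb_cat)
          then show "b \<in> syz Y n h" using f c(3) by (simp add: syz_def)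
        qed
      qed
      show ?thesis unfolding P_def
        using lift' g(3) h(3) submod_syz snd_part_lin
        by (intro exI[of _ "snd_part m"] exI[of _ 1]) (auto simp: ker img)
    qed
    ultimately show ?case by blast
  qed
qed

text \<open>
  Generators of \<open>B\<close> also generate the image of \<open>\<beta>\<close>.  A coefficient vector is a relation in the
  image if the combination of the generators of \<open>B\<close> lies in the kernel of \<open>\<beta>\<close>.  Hence the
  relations in the image are an extension of the kernel of \<open>\<beta>\<close> by the relations in \<open>B\<close>.  Forming the
  combination takes coefficient vectors of degree \<open>1\<close> to degree \<open>q + 1\<close>, which is where the kernel
  is required to be linear.
\<close>

lemma linear_quotient:
  assumes B: "linear_module Y q B" and \<beta>: "lin_on Y B \<beta>"
    and A: "linear_module Y (q + 1) {b \<in> B. \<beta> b = 0}"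
    and hom: "\<And>b. b \<in> B \<Longrightarrow> b \<in> hom_vecs Y q \<Longrightarrow> \<beta> b \<in> hom_vecs Y q'"
  shows "linear_module Y q' (\<beta> ` B)"
proof -
  obtain n g where g: "\<And>i. i < n \<Longrightarrow> g i \<in> hom_vecs Y q" "B = comb n g ` free_vecs Y n"
    "linear_module Y 1 (syz Y n g)"
    using B by (rule linear_moduleE) blast
  have gB: "\<forall>i<n. g i \<in> B"
    unfolding g(2) using gen_mem by blast
  note s = syz_comp[OF \<beta> linear_submod[OF B] gB]
  define K where "K = syz Y n (\<lambda>i. \<beta> (g i))"
  have 0: "\<beta> 0 = 0" by (rule lin_on_zero[OF \<beta> linear_submod[OF B]])
  have img: "comb n g ` K = {b \<in> B. \<beta> b = 0}"
    unfolding K_def s(1) g(2) by auto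
  have ker: "{c \<in> K. comb n g c = 0} = syz Y n g"
    unfolding K_def s(1) unfolding syz_def using 0 by auto
  have "linear_module Y 1 K"
  proof (rule linear_extension[where \<beta> = "comb n g" and q' = "q + 1"])
    show "submod Y K" unfolding K_def by (rule submod_syz)
    show "lin_on Y K (comb n g)" by (rule comb_lin)
    fix c assume c: "c \<in> comb n g ` K" "c \<in> hom_vecs Y (q + 1)"
    then obtain b where b: "b \<in> free_vecs Y n" "c = comb n g b" "\<beta> (comb n g b) = 0"
      unfolding K_def s(1) by auto
    have "comb n g b \<in> hom_vecs Y (q + 1)" using c b by simp
    from lift_homogeneous[OF g(1) b(1) this]
    obtain b' where "b' \<in> free_vecs Y n" "b' \<in> hom_vecs Y 1" "comb n g b' = comb n g b" by blast
    then show "\<exists>b\<in>K. b \<in> hom_vecs Y 1 \<and> comb n g b = c"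
      unfolding K_def s(1) using b by auto
  qed (use A g(3) in \<open>simp_all add: img ker\<close>)
  then have "linear_module Y q' (comb n (\<lambda>i. \<beta> (g i)) ` free_vecs Y n)"
    unfolding K_def using hom gB g(1) by (intro linear_moduleI) auto
  then show ?thesis unfolding s(2) g(2) .
qed

section \<open>Independence of the choice of minimal generators\<close>

lemma comb_comb:
  assumes "\<And>i. i < n \<Longrightarrow> A i \<in> free_vecs Y m" "c \<in> free_vecs Y n"
  shows "comb m g (comb n A c) = comb n (\<lambda>i. comb m g (A i)) c"
  by (rule lin_on_comb[OF comb_lin submod_free assms])

text \<open>
  Two lists of generators of degree \<open>q\<close> are expressed by each other with constant coefficients.  If
  neither list has a non-zero relation with constant coefficients, the two matrices are inverse to
  each other, and they carry the relations of one list to those of the other.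
\<close>

lemma linear_syz_minimal:
  assumes M: "linear_module Y q (comb m h ` free_vecs Y m)"
    and h: "\<And>i. i < m \<Longrightarrow> h i \<in> hom_vecs Y q"
    and min: "\<And>c. c \<in> syz Y m h \<Longrightarrow> c \<in> hom_vecs Y 0 \<Longrightarrow> c = 0"
  shows "linear_module Y 1 (syz Y m h)"
proof -
  obtain n g where g: "\<And>i. i < n \<Longrightarrow> g i \<in> hom_vecs Y q"
      "comb m h ` free_vecs Y m = comb n g ` free_vecs Y n" "linear_module Y 1 (syz Y n g)"
    using M by (rule linear_moduleE) blast
  have ming: "c = 0" if "c \<in> syz Y n g" "c \<in> hom_vecs Y 0" for c
    by (rule linear_below_degree[OF g(3) that]) simp
  have "\<exists>a. a \<in> free_vecs Y n \<and> a \<in> hom_vecs Y 0 \<and> comb n g a = h i" if i: "i < m" for i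
  proof -
    obtain c where c: "c \<in> free_vecs Y n" "comb n g c = h i"
      using gen_mem[OF i, of h Y] unfolding g(2) by auto
    then have "comb n g c \<in> hom_vecs Y (q + 0)" using h[OF i] by simp
    from lift_homogeneous[OF g(1) c(1) this] c(2) show ?thesis by metis
  qed
  then obtain A where A: "\<And>i. i < m \<Longrightarrow> A i \<in> free_vecs Y n"
      "\<And>i. i < m \<Longrightarrow> A i \<in> hom_vecs Y 0" "\<And>i. i < m \<Longrightarrow> comb n g (A i) = h i"
    by metis
  have "\<exists>a. a \<in> free_vecs Y m \<and> a \<in> hom_vecs Y 0 \<and> comb m h a = g i" if i: "i < n" for i
  proof -
    obtain c where c: "c \<in> free_vecs Y m" "comb m h c = g i"
      using gen_mem[OF i, of g Y] unfolding g(2)[symmetric] by auto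
    then have "comb m h c \<in> hom_vecs Y (q + 0)" using g(1)[OF i] by simp
    from lift_homogeneous[OF h c(1) this] c(2) show ?thesis by metis
  qed
  then obtain C where C: "\<And>i. i < n \<Longrightarrow> C i \<in> free_vecs Y m"
      "\<And>i. i < n \<Longrightarrow> C i \<in> hom_vecs Y 0" "\<And>i. i < n \<Longrightarrow> comb m h (C i) = g i"
    by metis
  have hom: "comb n C c \<in> hom_vecs Y j" if "c \<in> hom_vecs Y j" for c j
    using comb_hom[OF C(2) that] by simp
  have free: "comb n C c \<in> free_vecs Y m" if "c \<in> free_vecs Y n" for c
    by (rule comb_mem[OF submod_free C(1) that])
  have hC: "comb m h (comb n C c) = comb n g c" if c: "c \<in> free_vecs Y n" for c
  proof -
    have "comb m h (comb n C c) = comb n (\<lambda>i. comb m h (C i)) c" by (rule comb_comb[OF C(1) c])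
    also have "\<dots> = comb n g c" by (rule comb_cong) (simp_all add: C(3))
    finally show ?thesis .
  qed
  have freeA: "comb m A c \<in> free_vecs Y n" if "c \<in> free_vecs Y m" for c
    by (rule comb_mem[OF submod_free A(1) that])
  have gA: "comb n g (comb m A c) = comb m h c" if c: "c \<in> free_vecs Y m" for c
  proof -
    have "comb n g (comb m A c) = comb m (\<lambda>i. comb n g (A i)) c" by (rule comb_comb[OF A(1) c])
    also have "\<dots> = comb m h c" by (rule comb_cong) (simp_all add: A(3))
    finally show ?thesis .
  qed
  have CA: "comb n C (A i) = unit_vec i" if i: "i < m" for i
  proof -
    let ?d = "comb n C (A i) - unit_vec i"
    have "comb m h ?d = 0"
      using hC[OF A(1)[OF i]] A(3)[OF i] comb_unit_vec[OF i, of h] by (simp add: comb_diff)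
    then have "?d \<in> syz Y m h"
      unfolding syz_def using submod_diff[OF submod_free free[OF A(1)[OF i]] unit_vec_free[OF i]] by blast
    moreover have "?d \<in> hom_vecs Y 0" by (rule hom_vecs_diff[OF hom[OF A(2)[OF i]] unit_vec_hom])
    ultimately have "?d = 0" by (rule min)
    then show ?thesis by simp
  qed
  have AC: "comb m A (C i) = unit_vec i" if i: "i < n" for i
  proof -
    let ?d = "comb m A (C i) - unit_vec i"
    have "comb n g ?d = 0"
      using gA[OF C(1)[OF i]] C(3)[OF i] comb_unit_vec[OF i, of g] by (simp add: comb_diff)
    then have "?d \<in> syz Y n g"
      unfolding syz_def using submod_diff[OF submod_free freeA[OF C(1)[OF i]] unit_vec_free[OF i]] by blast
    moreover have "?d \<in> hom_vecs Y 0"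
      using comb_hom[OF A(2) C(2)[OF i]] by (intro hom_vecs_diff unit_vec_hom) simp
    ultimately have "?d = 0" by (rule ming)
    then show ?thesis by simp
  qed
  have inv1: "comb n C (comb m A c) = c" if c: "c \<in> free_vecs Y m" for c
  proof -
    have "comb n C (comb m A c) = comb m (\<lambda>i. comb n C (A i)) c" by (rule comb_comb[OF A(1) c])
    also have "\<dots> = comb m unit_vec c" by (rule comb_cong) (simp_all add: CA)
    also have "\<dots> = c" by (rule comb_unit_vecs[OF c])
    finally show ?thesis .
  qed
  have inv2: "comb m A (comb n C c) = c" if c: "c \<in> free_vecs Y n" for c
  proof -
    have "comb m A (comb n C c) = comb n (\<lambda>i. comb m A (C i)) c" by (rule comb_comb[OF C(1) c])
    also have "\<dots> = comb n unit_vec c" by (rule comb_cong) (simp_all add: AC)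
    also have "\<dots> = c" by (rule comb_unit_vecs[OF c])
    finally show ?thesis .
  qed
  have "syz Y m h = comb n C ` syz Y n g"
  proof
    show "comb n C ` syz Y n g \<subseteq> syz Y m h"
      using free hC by (auto simp: syz_def)
    show "syz Y m h \<subseteq> comb n C ` syz Y n g"
    proof
      fix c assume c: "c \<in> syz Y m h"
      then have f: "c \<in> free_vecs Y m" by (simp add: syz_def)
      have "comb m A c \<in> syz Y n g" using c freeA[OF f] gA[OF f] by (simp add: syz_def)
      with inv1[OF f] show "c \<in> comb n C ` syz Y n g" by (metis imageI)
    qed
  qed
  moreover have "linear_module Y 1 (comb n C ` syz Y n g)"
  proof (rule linear_iso[OF g(3) comb_lin])
    fix x assume x: "x \<in> syz Y n g" "comb n C x = 0"
    then have "x = comb m A 0" using inv2[of x] by (simp add: syz_def)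
    then show "x = 0" by simp
  qed (rule hom)
  ultimately show ?thesis by simp
qed

text \<open>
  Going through the list, a generator is kept only if it is not in the module generated by the
  earlier ones.  A relation with constant coefficients would express the last generator with a
  non-zero coefficient by earlier ones, since non-zero constants are invertible.
\<close>

lemma minimal_generators:
  assumes "\<forall>i<n. g i \<in> hom_vecs Y q"
  shows "\<exists>m h. (\<forall>i<m. h i \<in> hom_vecs Y q) \<and> comb m h ` free_vecs Y m = comb n g ` free_vecs Y n \<and>
    (\<forall>c\<in>syz Y m h. c \<in> hom_vecs Y 0 \<longrightarrow> c = 0)"
  using assms
proof (induction n)
  case 0
  show ?case
    by (intro exI[of _ 0] exI[of _ g]) (auto simp: syz_def free_vecs_def fun_eq_iff)
next
  case (Suc n)
  then obtain m h where h: "\<And>i. i < m \<Longrightarrow> h i \<in> hom_vecs Y q"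
    "comb m h ` free_vecs Y m = comb n g ` free_vecs Y n"
    "\<And>c. c \<in> syz Y m h \<Longrightarrow> c \<in> hom_vecs Y 0 \<Longrightarrow> c = 0"
    by (metis less_SucI)
  let ?M = "comb n g ` free_vecs Y n"
  let ?w = "\<lambda>_. g n"
  have one: "comb (Suc 0) ?w c = c 0 \<cdot> g n" for c by (simp add: comb_def)
  have oneI: "p \<cdot> g n \<in> comb (Suc 0) ?w ` free_vecs Y (Suc 0)" if "p \<in> polys Y" for p
    by (rule image_eqI[of _ _ "\<lambda>i. if i = 0 then p else 0"])
      (use that in \<open>auto simp: one free_vecs_def\<close>)
  have "comb (n + Suc 0) g = comb (n + Suc 0) (cat n g ?w)"
    by (rule ext, rule comb_cong) (auto simp: cat_def less_Suc_eq)
  then have gn: "comb (Suc n) g ` free_vecs Y (Suc n) =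
      {x + y | x y. x \<in> ?M \<and> y \<in> comb (Suc 0) ?w ` free_vecs Y (Suc 0)}"
    using comb_cat_image[of n "Suc 0" g ?w Y] by simp
  show ?case
  proof (cases "g n \<in> ?M")
    case True
    have "comb (Suc n) g ` free_vecs Y (Suc n) = ?M"
    proof
      show "comb (Suc n) g ` free_vecs Y (Suc n) \<subseteq> ?M"
        unfolding gn
        by (auto simp only: one
            intro!: submod_add[OF submod_comb_image] submod_smul[OF submod_comb_image _ True]
            intro: free_vecs_polys)
      show "?M \<subseteq> comb (Suc n) g ` free_vecs Y (Suc n)"
      proof
        fix x assume "x \<in> ?M"
        moreover have "0 \<in> comb (Suc 0) ?w ` free_vecs Y (Suc 0)" using oneI[of 0] by simp
        moreover have "x = x + 0" by simp
        ultimately show "x \<in> comb (Suc n) g ` free_vecs Y (Suc n)" unfolding gn by blast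
      qed
    qed
    with h show ?thesis by metis
  next
    case False
    let ?G = "cat m h ?w"
    have "?G i \<in> hom_vecs Y q" if "i < m + Suc 0" for i
      using that h(1) Suc.prems by (auto simp: cat_def)
    moreover have "comb (m + Suc 0) ?G ` free_vecs Y (m + Suc 0) = comb (Suc n) g ` free_vecs Y (Suc n)"
      unfolding gn comb_cat_image h(2) ..
    moreover have "c = 0" if c: "c \<in> syz Y (m + Suc 0) ?G" "c \<in> hom_vecs Y 0" for c
    proof -
      have f: "c \<in> free_vecs Y (m + Suc 0)" and c0: "comb m h (fst_part m c) + c m \<cdot> g n = 0"
        using c comb_cat[of m "Suc 0" h ?w c] by (auto simp: syz_def one snd_part_def)
      have cm: "c m = 0"
      proof (rule ccontr)
        assume "c m \<noteq> 0"
        then obtain p where p: "p \<in> homogeneous Y 0" "p * c m = 1"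
          using homogeneous_0_inverse[of "c m" Y] c(2) by (auto simp: hom_vecs_def)
        have "g n = (p * c m) \<cdot> g n" by (simp add: p)
        also have "\<dots> = p \<cdot> c m \<cdot> g n" by (simp add: smul_smul)
        also have "c m \<cdot> g n = - comb m h (fst_part m c)"
          using c0 by (simp add: eq_neg_iff_add_eq_0 add.commute)
        finally have "g n = p \<cdot> (- comb m h (fst_part m c))" .
        moreover have "p \<cdot> (- comb m h (fst_part m c)) \<in> ?M"
          unfolding h(2)[symmetric]
          by (intro submod_smul[OF submod_comb_image] submod_uminus[OF submod_comb_image]
              homogeneous_polys[OF p(1)] imageI fst_part_free[OF f])
        ultimately show False using False by metis
      qed
      then have "fst_part m c \<in> syz Y m h"
        using c0 fst_part_free[OF f] by (simp add: syz_def)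
      then have "fst_part m c = 0" using h(3) fst_part_hom[OF c(2)] by blast
      moreover have "snd_part m c = 0"
        using f cm by (auto simp: snd_part_def free_vecs_def fun_eq_iff) (metis add_0_right add_Suc_right gr0_conv_Suc le_add1 not_gr0 Suc_le_mono)
      ultimately show "c = 0" by (rule parts_zero)
    qed
    ultimately show ?thesis by blast
  qed
qed

section \<open>Direct summands\<close>

text \<open>
  Minimal generators of the image of the projection \<open>\<pi>\<close> and of the complementary summand are
  together minimal generators of \<open>P\<close>, so their relation module is linear.  Applying \<open>\<pi>\<close> to a
  relation splits it into a relation on each summand; thus \<open>fst_part\<close> projects the relation module
  onto the relation module of the image of \<open>\<pi>\<close>, and coinduction applies.
\<close>

lemma linear_summand:
  fixes P :: "(nat \<Rightarrow> ('v, 'k::field) mpoly) set"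
  assumes "linear_module Y q P" "lin_on Y P \<pi>"
    and "\<And>x. x \<in> P \<Longrightarrow> \<pi> x \<in> P \<and> \<pi> (\<pi> x) = \<pi> x"
    and "\<And>x. x \<in> P \<Longrightarrow> x \<in> hom_vecs Y q \<Longrightarrow> \<pi> x \<in> hom_vecs Y q"
  shows "linear_module Y q (\<pi> ` P)"
proof -
  define S where "S = (\<lambda>q (M :: (nat \<Rightarrow> ('v, 'k) mpoly) set). \<exists>\<pi> P. M = \<pi> ` P \<and> linear_module Y q P \<and> lin_on Y P \<pi> \<and>
    (\<forall>x\<in>P. \<pi> x \<in> P \<and> \<pi> (\<pi> x) = \<pi> x) \<and> (\<forall>x\<in>P. x \<in> hom_vecs Y q \<longrightarrow> \<pi> x \<in> hom_vecs Y q))"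
  have "linear_module Y q M" if "S q M" for q M
    using that
  proof (coinduction arbitrary: q M)
    case (linear_module q M)
    then obtain \<pi> P where M: "M = \<pi> ` P" and P: "linear_module Y q P" "lin_on Y P \<pi>"
      and idem: "\<And>x. x \<in> P \<Longrightarrow> \<pi> x \<in> P \<and> \<pi> (\<pi> x) = \<pi> x"
      and hom: "\<And>x. x \<in> P \<Longrightarrow> x \<in> hom_vecs Y q \<Longrightarrow> \<pi> x \<in> hom_vecs Y q"
      unfolding S_def by blast
    note sP = linear_submod[OF P(1)]
    obtain n g where g: "\<And>i. i < n \<Longrightarrow> g i \<in> hom_vecs Y q" "P = comb n g ` free_vecs Y n"
      using P(1) by (rule linear_moduleE) blast
    have gP: "\<forall>i<n. g i \<in> P" unfolding g(2) using gen_mem by blast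
    define \<rho> where "\<rho> x = x - \<pi> x" for x
    have \<rho>: "lin_on Y P \<rho>"
      unfolding lin_on_def \<rho>_def
      by (auto simp: lin_on_add[OF P(2)] lin_on_smul[OF P(2)] fun_eq_iff right_diff_distrib)
    have \<pi>g: "\<forall>i<n. \<pi> (g i) \<in> hom_vecs Y q"
      using hom gP g(1) by blast
    have \<rho>g: "\<forall>i<n. \<rho> (g i) \<in> hom_vecs Y q"
      unfolding \<rho>_def using hom_vecs_diff[OF g(1)] \<pi>g by blast
    from minimal_generators[of n "\<lambda>i. \<pi> (g i)" Y q, OF \<pi>g]
    obtain s u where u: "\<forall>i<s. u i \<in> hom_vecs Y q"
        "comb s u ` free_vecs Y s = comb n (\<lambda>i. \<pi> (g i)) ` free_vecs Y n"
        "\<forall>c\<in>syz Y s u. c \<in> hom_vecs Y 0 \<longrightarrow> c = 0"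
      by (elim exE conjE)
    from minimal_generators[of n "\<lambda>i. \<rho> (g i)" Y q, OF \<rho>g]
    obtain t w where w: "\<forall>i<t. w i \<in> hom_vecs Y q"
        "comb t w ` free_vecs Y t = comb n (\<lambda>i. \<rho> (g i)) ` free_vecs Y n"
        "\<forall>c\<in>syz Y t w. c \<in> hom_vecs Y 0 \<longrightarrow> c = 0"
      by (elim exE conjE)
    have uM: "comb s u ` free_vecs Y s = \<pi> ` P"
      unfolding u(2) syz_comp(2)[OF P(2) sP gP] g(2) ..
    have wM: "comb t w ` free_vecs Y t = \<rho> ` P"
      unfolding w(2) syz_comp(2)[OF \<rho> sP gP] g(2) ..
    have u\<pi>: "comb s u a \<in> P" "\<pi> (comb s u a) = comb s u a" if "a \<in> free_vecs Y s" for a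
    proof -
      have "comb s u a \<in> \<pi> ` P" unfolding uM[symmetric] using that by (rule imageI)
      then show "comb s u a \<in> P" "\<pi> (comb s u a) = comb s u a" using idem by auto
    qed
    have w\<pi>: "comb t w b \<in> P" "\<pi> (comb t w b) = 0" if "b \<in> free_vecs Y t" for b
    proof -
      obtain x where x: "x \<in> P" "comb t w b = x - \<pi> x"
        using imageI[OF \<open>b \<in> free_vecs Y t\<close>, of "comb t w"] unfolding wM \<rho>_def by blast
      show "comb t w b \<in> P" unfolding x(2) using x(1) idem[OF x(1)] by (intro submod_diff[OF sP]) auto
      have "\<pi> (x - \<pi> x) = \<pi> x - \<pi> (\<pi> x)"
        using x(1) idem[OF x(1)] by (intro lin_on_diff[OF P(2) sP]) auto
      then show "\<pi> (comb t w b) = 0" using x idem[OF x(1)] by simp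
    qed
    let ?G = "cat s u w"
    have split: "comb s u (fst_part s c) = 0 \<and> comb t w (snd_part s c) = 0"
      if c: "c \<in> syz Y (s + t) ?G" for c
    proof -
      have f: "c \<in> free_vecs Y (s + t)" and c0: "comb s u (fst_part s c) + comb t w (snd_part s c) = 0"
        using c by (auto simp: syz_def comb_cat)
      note ff = fst_part_free[OF f] snd_part_free[OF f]
      have "\<pi> (comb s u (fst_part s c) + comb t w (snd_part s c)) =
          \<pi> (comb s u (fst_part s c)) + \<pi> (comb t w (snd_part s c))"
        by (rule lin_on_add[OF P(2) u\<pi>(1)[OF ff(1)] w\<pi>(1)[OF ff(2)]])
      moreover have "\<pi> 0 = 0" by (rule lin_on_zero[OF P(2) sP])
      ultimately have "comb s u (fst_part s c) = 0"
        using c0 u\<pi>(2)[OF ff(1)] w\<pi>(2)[OF ff(2)] by simp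
      with c0 show ?thesis by simp
    qed
    have "linear_module Y 1 (syz Y (s + t) ?G)"
    proof (rule linear_syz_minimal)
      have "P = comb (s + t) ?G ` free_vecs Y (s + t)"
      proof
        show "comb (s + t) ?G ` free_vecs Y (s + t) \<subseteq> P"
          unfolding comb_cat_image using u\<pi>(1) w\<pi>(1) submod_add[OF sP] by auto
        show "P \<subseteq> comb (s + t) ?G ` free_vecs Y (s + t)"
        proof
          fix x assume "x \<in> P"
          moreover have "x = \<pi> x + \<rho> x" by (simp add: \<rho>_def)
          ultimately show "x \<in> comb (s + t) ?G ` free_vecs Y (s + t)"
            unfolding comb_cat_image uM wM by blast
        qed
      qed
      then show "linear_module Y q (comb (s + t) ?G ` free_vecs Y (s + t))" using P(1) by simp
      show "?G i \<in> hom_vecs Y q" if "i < s + t" for i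
        using that u(1) w(1) by (auto simp: cat_def)
      show "c = 0" if c: "c \<in> syz Y (s + t) ?G" "c \<in> hom_vecs Y 0" for c
      proof -
        have f: "c \<in> free_vecs Y (s + t)" using c by (simp add: syz_def)
        have "fst_part s c = 0"
          using split[OF c(1)] fst_part_free[OF f] fst_part_hom[OF c(2)] by (intro u(3)[rule_format]) (auto simp: syz_def)
        moreover have "snd_part s c = 0"
          using split[OF c(1)] snd_part_free[OF f] snd_part_hom[OF c(2)] by (intro w(3)[rule_format]) (auto simp: syz_def)
        ultimately show "c = 0" by (rule parts_zero)
      qed
    qed
    moreover have img: "fst_part s ` syz Y (s + t) ?G = syz Y s u"
    proof
      show "fst_part s ` syz Y (s + t) ?G \<subseteq> syz Y s u"
        using split fst_part_free[of _ Y s t] by (auto simp: syz_def)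
      show "syz Y s u \<subseteq> fst_part s ` syz Y (s + t) ?G"
      proof
        fix a assume a: "a \<in> syz Y s u"
        then have f: "a \<in> free_vecs Y s" by (simp add: syz_def)
        have "a \<in> free_vecs Y (s + t)" by (rule free_vecs_mono[OF f]) simp
        moreover have "snd_part s a = 0"
          using f by (auto simp: free_vecs_def snd_part_def fun_eq_iff)
        ultimately have "a \<in> syz Y (s + t) ?G"
          using a fst_part_self[OF f] by (auto simp: syz_def comb_cat)
        then show "a \<in> fst_part s ` syz Y (s + t) ?G" using fst_part_self[OF f] by (metis imageI)
      qed
    qed
    moreover have "fst_part s x \<in> syz Y (s + t) ?G \<and> fst_part s (fst_part s x) = fst_part s x"
      if x: "x \<in> syz Y (s + t) ?G" for x
    proof -
      have f: "x \<in> free_vecs Y (s + t)" using x by (simp add: syz_def)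
      have "fst_part s x \<in> free_vecs Y (s + t)" using f by (auto simp: free_vecs_def fst_part_def)
      moreover have "snd_part s (fst_part s x) = 0" by (auto simp: snd_part_def fst_part_def fun_eq_iff)
      moreover have "fst_part s (fst_part s x) = fst_part s x" by (auto simp: fst_part_def)
      ultimately show ?thesis using split[OF x] by (auto simp: syz_def comb_cat)
    qed
    ultimately have "S 1 (syz Y s u)"
      unfolding S_def using fst_part_lin fst_part_hom
      by (intro exI[of _ "fst_part s"] exI[of _ "syz Y (s + t) ?G"]) auto
    with u(1) show ?case unfolding M uM[symmetric] by blast
  qed
  moreover have "S q (\<pi> ` P)" unfolding S_def using assms by blast
  ultimately show ?thesis by blast
qed

section \<open>Squarefree monomial ideals\<close>

text \<open>
  If \<open>N\<close> is closed under supersets, this is the ideal generated by the squarefree monomials with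
  support in \<open>N\<close>, because a monomial belongs to such an ideal if and only if its radical does.
  Unions and intersections of such \<open>N\<close> correspond to sums and intersections of ideals.
\<close>

definition sqfree :: "'v set set \<Rightarrow> ('v, 'k::field) mpoly set" where
  "sqfree N = mons_in {m. Poly_Mapping.keys m \<in> N}"

text \<open>
  Linearity is defined for submodules of free modules; an ideal is regarded as a submodule of the
  free module of rank one.
\<close>

definition ideal_vecs :: "('v, 'k::field) mpoly set \<Rightarrow> (nat \<Rightarrow> ('v, 'k) mpoly) set" where
  "ideal_vecs I = {x. x 0 \<in> I \<and> (\<forall>i>0. x i = 0)}"

definition upset :: "'v set \<Rightarrow> 'v set set \<Rightarrow> bool" where
  "upset Y N \<longleftrightarrow> N \<subseteq> Pow Y \<and> (\<forall>F\<in>N. \<forall>G. F \<subseteq> G \<longrightarrow> G \<subseteq> Y \<longrightarrow> G \<in> N)"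

lemma sqfree_add: "p \<in> sqfree N \<Longrightarrow> q \<in> sqfree N \<Longrightarrow> p + q \<in> sqfree N"
  by (simp add: sqfree_def mons_in_add)
lemma sqfree_uminus: "p \<in> sqfree N \<Longrightarrow> - p \<in> sqfree N"
  by (simp add: sqfree_def mons_in_uminus)
lemma sqfree_zero [simp]: "0 \<in> sqfree N"
  by (simp add: sqfree_def)
lemma sqfree_mult: "upset Y N \<Longrightarrow> p \<in> polys Y \<Longrightarrow> q \<in> sqfree N \<Longrightarrow> p * q \<in> sqfree N"
  unfolding sqfree_def polys_eq
  by (erule mons_in_mult) (auto simp: upset_def keys_add_nat)
lemma sqfree_mono: "p \<in> sqfree N \<Longrightarrow> N \<subseteq> N' \<Longrightarrow> p \<in> sqfree N'"
  by (auto simp: sqfree_def mons_in_def)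
lemma sqfree_inter: "sqfree (N \<inter> N') = sqfree N \<inter> sqfree N'"
  by (auto simp: sqfree_def mons_in_def)

section \<open>The Mayer-Vietoris sequence\<close>

text \<open>
  The direct sum of two ideals as a submodule of the free module of rank two, and the maps of the
  exact sequence \<open>0 \<rightarrow> I \<inter> J \<rightarrow> I \<oplus> J \<rightarrow> I + J \<rightarrow> 0\<close>, whose second map is \<open>antidiagonal\<close> and whose third map
  is \<open>parts_sum\<close>.
\<close>

definition pairs :: "'v set set \<Rightarrow> 'v set set \<Rightarrow> (nat \<Rightarrow> ('v, 'k::field) mpoly) set" where
  "pairs N N' = {x. x 0 \<in> sqfree N \<and> x 1 \<in> sqfree N' \<and> (\<forall>i>1. x i = 0)}"

definition left_part :: "(nat \<Rightarrow> ('v, 'k::field) mpoly) \<Rightarrow> nat \<Rightarrow> ('v, 'k) mpoly" where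
  "left_part x = (\<lambda>i. if i = 0 then x 0 else 0)"
definition right_part :: "(nat \<Rightarrow> ('v, 'k::field) mpoly) \<Rightarrow> nat \<Rightarrow> ('v, 'k) mpoly" where
  "right_part x = (\<lambda>i. if i = 0 then x 1 else 0)"
definition parts_sum :: "(nat \<Rightarrow> ('v, 'k::field) mpoly) \<Rightarrow> nat \<Rightarrow> ('v, 'k) mpoly" where
  "parts_sum x = (\<lambda>i. if i = 0 then x 0 + x 1 else 0)"
definition antidiagonal :: "(nat \<Rightarrow> ('v, 'k::field) mpoly) \<Rightarrow> nat \<Rightarrow> ('v, 'k) mpoly" where
  "antidiagonal x = (\<lambda>i. if i = 0 then x 0 else if i = 1 then - x 0 else 0)"

lemma pair_maps_lin:
  "lin_on Y M left_part" "lin_on Y M right_part" "lin_on Y M parts_sum" "lin_on Y M antidiagonal"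
  by (auto simp: lin_on_def left_part_def right_part_def parts_sum_def antidiagonal_def fun_eq_iff algebra_simps)

lemma pair_maps_hom:
  "x \<in> hom_vecs Y j \<Longrightarrow> left_part x \<in> hom_vecs Y j" "x \<in> hom_vecs Y j \<Longrightarrow> right_part x \<in> hom_vecs Y j"
  "x \<in> hom_vecs Y j \<Longrightarrow> parts_sum x \<in> hom_vecs Y j" "x \<in> hom_vecs Y j \<Longrightarrow> antidiagonal x \<in> hom_vecs Y j"
  by (auto simp: hom_vecs_def left_part_def right_part_def parts_sum_def antidiagonal_def
      homogeneous_add homogeneous_uminus)

lemma submod_pairs: "upset Y N \<Longrightarrow> upset Y N' \<Longrightarrow> submod Y (pairs N N')"
  by (auto simp: submod_def pairs_def sqfree_add sqfree_mult)

lemma parts_sum_kernel: "{x \<in> pairs N N'. parts_sum x = 0} = antidiagonal ` ideal_vecs (sqfree (N \<inter> N'))"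
proof
  show "{x \<in> pairs N N'. parts_sum x = 0} \<subseteq> antidiagonal ` ideal_vecs (sqfree (N \<inter> N'))"
  proof
    fix x assume x: "x \<in> {x \<in> pairs N N'. parts_sum x = 0}"
    then have "x 0 + x 1 = 0" by (auto simp: parts_sum_def fun_eq_iff split: if_splits)
    then have x1: "x 1 = - x 0" by (simp add: eq_neg_iff_add_eq_0 add.commute)
    have x0: "x 0 \<in> sqfree (N \<inter> N')"
      using x sqfree_uminus[of "x 1" N'] x1 by (simp add: pairs_def sqfree_inter)
    have "x = antidiagonal (left_part x)"
      using x x1 by (auto simp: antidiagonal_def left_part_def pairs_def fun_eq_iff)
    moreover have "left_part x \<in> ideal_vecs (sqfree (N \<inter> N'))"
      using x0 by (simp add: ideal_vecs_def left_part_def)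
    ultimately show "x \<in> antidiagonal ` ideal_vecs (sqfree (N \<inter> N'))" by blast
  qed
  show "antidiagonal ` ideal_vecs (sqfree (N \<inter> N')) \<subseteq> {x \<in> pairs N N'. parts_sum x = 0}"
    by (auto simp: antidiagonal_def ideal_vecs_def pairs_def parts_sum_def fun_eq_iff sqfree_inter sqfree_uminus)
qed

text \<open>
  An element of \<open>I + J\<close> is split by distributing its monomials; this splits a homogeneous element
  into homogeneous ones.
\<close>

lemma parts_sum_lift:
  assumes "c \<in> ideal_vecs (sqfree (N \<union> N'))"
  obtains x where "x \<in> pairs N N'" "parts_sum x = c" "\<And>Y j. c \<in> hom_vecs Y j \<Longrightarrow> x \<in> hom_vecs Y j"
proof -
  let ?K = "Poly_Mapping.keys (c 0)"
  have "c 0 \<in> mons_in ((?K \<inter> {m. Poly_Mapping.keys m \<in> N}) \<union> (?K \<inter> {m. Poly_Mapping.keys m \<in> N'}))"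
    using assms by (auto simp: ideal_vecs_def sqfree_def mons_in_def)
  then obtain q r where qr: "q \<in> mons_in (?K \<inter> {m. Poly_Mapping.keys m \<in> N})"
    "r \<in> mons_in (?K \<inter> {m. Poly_Mapping.keys m \<in> N'} - ?K \<inter> {m. Poly_Mapping.keys m \<in> N})" "c 0 = q + r"
    by (rule mons_in_split)
  let ?x = "\<lambda>i::nat. if i = 0 then q else if i = 1 then r else 0"
  show thesis
  proof (rule that)
    show "?x \<in> pairs N N'" using qr by (auto simp: pairs_def sqfree_def mons_in_def)
    show "parts_sum ?x = c" using qr(3) assms by (auto simp: parts_sum_def ideal_vecs_def fun_eq_iff)
    fix Y j assume "c \<in> hom_vecs Y j"
    then have "?K \<subseteq> {m. Poly_Mapping.keys m \<subseteq> Y \<and> int (mon_degree m) = j}"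
      by (auto simp: hom_vecs_def homogeneous_eq mons_in_def)
    then show "?x \<in> hom_vecs Y j"
      using qr(1,2) by (auto simp: hom_vecs_def homogeneous_eq mons_in_def)
  qed
qed

lemma parts_sum_image: "parts_sum ` pairs N N' = ideal_vecs (sqfree (N \<union> N'))"
proof
  show "parts_sum ` pairs N N' \<subseteq> ideal_vecs (sqfree (N \<union> N'))"
    by (auto simp: parts_sum_def ideal_vecs_def pairs_def intro!: sqfree_add intro: sqfree_mono)
  show "ideal_vecs (sqfree (N \<union> N')) \<subseteq> parts_sum ` pairs N N'"
    by (metis image_eqI subsetI parts_sum_lift)
qed

lemma left_part_image: "left_part ` pairs N N' = ideal_vecs (sqfree N)"
proof
  show "ideal_vecs (sqfree N) \<subseteq> left_part ` pairs N N'"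
  proof
    fix x assume "x \<in> ideal_vecs (sqfree N)"
    then have "x \<in> pairs N N'" "left_part x = x"
      by (auto simp: ideal_vecs_def pairs_def left_part_def fun_eq_iff)
    then show "x \<in> left_part ` pairs N N'" by (metis imageI)
  qed
qed (auto simp: ideal_vecs_def pairs_def left_part_def)

lemma right_part_lift:
  assumes "c \<in> ideal_vecs (sqfree N')"
  obtains x where "x \<in> pairs N N'" "right_part x = c" "\<And>Y j. c \<in> hom_vecs Y j \<Longrightarrow> x \<in> hom_vecs Y j"
  by (rule that[of "\<lambda>i. if i = 1 then c 0 else 0"])
    (use assms in \<open>auto simp: ideal_vecs_def pairs_def right_part_def hom_vecs_def fun_eq_iff\<close>)

lemma right_part_image: "right_part ` pairs N N' = ideal_vecs (sqfree N')"
proof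
  show "ideal_vecs (sqfree N') \<subseteq> right_part ` pairs N N'"
    by (metis image_eqI subsetI right_part_lift)
qed (auto simp: ideal_vecs_def pairs_def right_part_def)

lemma right_part_kernel: "{x \<in> pairs N N'. right_part x = 0} = ideal_vecs (sqfree N)"
proof
  show "{x \<in> pairs N N'. right_part x = 0} \<subseteq> ideal_vecs (sqfree N)"
  proof
    fix x assume x: "x \<in> {x \<in> pairs N N'. right_part x = 0}"
    then have "x 1 = 0" by (auto simp: right_part_def fun_eq_iff split: if_splits)
    then have "x i = 0" if "i > 0" for i using x that by (cases "i = 1") (auto simp: pairs_def)
    with x show "x \<in> ideal_vecs (sqfree N)" by (auto simp: ideal_vecs_def pairs_def)
  qed
qed (auto simp: ideal_vecs_def pairs_def right_part_def fun_eq_iff)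

lemma linear_antidiagonal:
  assumes "linear_module Y q (ideal_vecs (sqfree N) :: (nat \<Rightarrow> ('v, 'k::field) mpoly) set)"
  shows "linear_module Y q (antidiagonal ` ideal_vecs (sqfree N) :: (nat \<Rightarrow> ('v, 'k::field) mpoly) set)"
proof (rule linear_iso[OF assms pair_maps_lin(4)])
  fix x :: "nat \<Rightarrow> ('v, 'k) mpoly" assume x: "x \<in> ideal_vecs (sqfree N)" "antidiagonal x = 0"
  have "x 0 = 0" using fun_cong[OF x(2), of 0] by (simp add: antidiagonal_def)
  then have "x i = 0" for i using x(1) by (cases "i = 0") (auto simp: ideal_vecs_def)
  then show "x = 0" by (simp add: fun_eq_iff)
qed (rule pair_maps_hom)

text \<open>
  By the Mayer-Vietoris sequence \<open>I \<oplus> J\<close> is an extension of linear modules in the same degree, and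
  \<open>I\<close> is a direct summand of it.
\<close>

lemma linear_inter_union_imp_left:
  assumes N: "upset Y N" "upset Y N'"
    and "linear_module Y q (ideal_vecs (sqfree (N \<inter> N')) :: (nat \<Rightarrow> ('v, 'k::field) mpoly) set)"
    and "linear_module Y q (ideal_vecs (sqfree (N \<union> N')) :: (nat \<Rightarrow> ('v, 'k::field) mpoly) set)"
  shows "linear_module Y q (ideal_vecs (sqfree N) :: (nat \<Rightarrow> ('v, 'k::field) mpoly) set)"
proof -
  let ?P = "pairs N N' :: (nat \<Rightarrow> ('v, 'k) mpoly) set"
  have "linear_module Y q ?P"
  proof (rule linear_extension[where \<beta> = parts_sum and q' = q])
    fix c :: "nat \<Rightarrow> ('v, 'k) mpoly" assume "c \<in> parts_sum ` ?P" "c \<in> hom_vecs Y q"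
    then show "\<exists>b\<in>?P. b \<in> hom_vecs Y q \<and> parts_sum b = c"
      unfolding parts_sum_image by (metis parts_sum_lift)
  qed (use assms in \<open>simp_all add: submod_pairs pair_maps_lin parts_sum_kernel parts_sum_image linear_antidiagonal\<close>)
  then have "linear_module Y q (left_part ` ?P)"
    by (rule linear_summand[OF _ pair_maps_lin(1)])
      (auto simp: pairs_def left_part_def intro: pair_maps_hom[unfolded left_part_def])
  then show ?thesis by (simp add: left_part_image)
qed

text \<open>
  The Mayer-Vietoris sequence again, now with \<open>I + J\<close> as the quotient of \<open>I \<oplus> J\<close>, which is linear as
  an extension of \<open>J\<close> by \<open>I\<close>.
\<close>

lemma linear_union:
  assumes N: "upset Y N" "upset Y N'"
    and "linear_module Y (q + 1) (ideal_vecs (sqfree (N \<inter> N')) :: (nat \<Rightarrow> ('v, 'k::field) mpoly) set)"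
    and "linear_module Y q (ideal_vecs (sqfree N) :: (nat \<Rightarrow> ('v, 'k::field) mpoly) set)"
    and "linear_module Y q (ideal_vecs (sqfree N') :: (nat \<Rightarrow> ('v, 'k::field) mpoly) set)"
  shows "linear_module Y q (ideal_vecs (sqfree (N \<union> N')) :: (nat \<Rightarrow> ('v, 'k::field) mpoly) set)"
proof -
  let ?P = "pairs N N' :: (nat \<Rightarrow> ('v, 'k) mpoly) set"
  have "linear_module Y q ?P"
  proof (rule linear_extension[where \<beta> = right_part and q' = q])
    fix c :: "nat \<Rightarrow> ('v, 'k) mpoly" assume "c \<in> right_part ` ?P" "c \<in> hom_vecs Y q"
    then show "\<exists>b\<in>?P. b \<in> hom_vecs Y q \<and> right_part b = c"
      unfolding right_part_image by (metis right_part_lift)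
  qed (use assms in \<open>simp_all add: submod_pairs pair_maps_lin right_part_kernel right_part_image\<close>)
  then have "linear_module Y q (parts_sum ` ?P)"
    by (rule linear_quotient[OF _ pair_maps_lin(3)])
      (use assms in \<open>simp_all add: parts_sum_kernel linear_antidiagonal pair_maps_hom\<close>)
  then show ?thesis by (simp add: parts_sum_image)
qed

section \<open>Multiplication by a new variable\<close>

text \<open>
  Multiplication by a monomial shifts coefficients and is therefore injective, also for variables
  without a linear order.
\<close>

lemma lookup_monom_mult:
  fixes p :: "('v, 'k::field) mpoly"
  shows "Poly_Mapping.lookup (Poly_Mapping.single m 1 * p) (m + n) = Poly_Mapping.lookup p n"
proof -
  have "Poly_Mapping.lookup (Poly_Mapping.single m 1 * p) (m + n) =
      (\<Sum>q. (1 when m = q) * (\<Sum>n'. Poly_Mapping.lookup p n' when m + n = q + n'))"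
    by (simp add: lookup_mult lookup_single)
  also have "\<dots> = (\<Sum>q. (\<Sum>n'. Poly_Mapping.lookup p n' when m + n = q + n') when m = q)"
    by (rule arg_cong[of _ _ Sum_any]) (auto simp: when_def)
  also have "\<dots> = (\<Sum>n'. Poly_Mapping.lookup p n' when m + n = m + n')" by simp
  also have "\<dots> = (\<Sum>n'. Poly_Mapping.lookup p n' when n' = n)"
    by (rule arg_cong[of _ _ Sum_any]) (auto simp: when_def)
  also have "\<dots> = Poly_Mapping.lookup p n" by simp
  finally show ?thesis .
qed

lemma var_homogeneous: "b \<in> Y \<Longrightarrow> var b \<in> homogeneous Y 1"
  by (simp add: var_def homogeneous_eq mons_in_def mon_degree_def)

text \<open>
  The condition on \<open>b\<close> says that the generators of the ideal \<open>I\<close> of \<open>N\<close> do not involve the variable \<open>b\<close>.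
  Then the monomials of \<open>I\<close> divisible by this variable are its multiples by monomials of \<open>I\<close>, so the
  new ideal is isomorphic to \<open>I\<close>, shifted by one degree.
\<close>

lemma linear_shift:
  assumes N: "upset Y N" and b: "b \<in> Y" and inv: "\<And>F. F \<subseteq> Y \<Longrightarrow> F \<in> N \<longleftrightarrow> F - {b} \<in> N"
    and lin: "linear_module Y q (ideal_vecs (sqfree N) :: (nat \<Rightarrow> ('v, 'k::field) mpoly) set)"
  shows "linear_module Y (q + 1) (ideal_vecs (sqfree {F \<in> N. b \<in> F}) :: (nat \<Rightarrow> ('v, 'k::field) mpoly) set)"
proof -
  let ?M = "ideal_vecs (sqfree N) :: (nat \<Rightarrow> ('v, 'k::field) mpoly) set"
  let ?m = "Poly_Mapping.single b (1::nat)"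
  let ?x = "var b :: ('v, 'k) mpoly"
  have var: "?x \<in> homogeneous Y 1" by (rule var_homogeneous[OF b])
  have "linear_module Y (q + 1) ((\<lambda>x. ?x \<cdot> x) ` ?M)"
  proof (rule linear_iso[OF lin])
    show "lin_on Y ?M (\<lambda>x. ?x \<cdot> x)"
      by (auto simp: lin_on_def smul_add smul_smul mult.commute)
    fix x assume x: "x \<in> ?M" "?x \<cdot> x = 0"
    have "x i = 0" for i
    proof (rule poly_mapping_eqI)
      fix n
      have "?x * x i = 0" using fun_cong[OF x(2), of i] by simp
      then show "Poly_Mapping.lookup (x i) n = Poly_Mapping.lookup 0 n"
        using lookup_monom_mult[of ?m "x i" n] by (simp add: var_def)
    qed
    then show "x = 0" by (simp add: fun_eq_iff)
  next
    fix x :: "nat \<Rightarrow> ('v, 'k) mpoly" assume "x \<in> hom_vecs Y q"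
    then show "?x \<cdot> x \<in> hom_vecs Y (q + 1)" using hom_vecs_smul[OF var, of x q] by (simp add: add.commute)
  qed
  moreover have "(\<lambda>x. ?x \<cdot> x) ` ?M = ideal_vecs (sqfree {F \<in> N. b \<in> F})"
  proof
    show "(\<lambda>x. ?x \<cdot> x) ` ?M \<subseteq> ideal_vecs (sqfree {F \<in> N. b \<in> F})"
    proof clarify
      fix x assume x: "x \<in> ?M"
      have "?x * x 0 \<in> sqfree {F \<in> N. b \<in> F}"
        unfolding sqfree_def
      proof (rule mons_in_mult)
        show "?x \<in> mons_in {?m}" by (simp add: var_def mons_in_def)
        show "x 0 \<in> mons_in {m. Poly_Mapping.keys m \<in> N}" using x by (simp add: ideal_vecs_def sqfree_def)
        fix m n :: "'v \<Rightarrow>\<^sub>0 nat" assume mn: "m \<in> {?m}" "n \<in> {m. Poly_Mapping.keys m \<in> N}"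
        then have "Poly_Mapping.keys n \<subseteq> insert b (Poly_Mapping.keys n)"
            "insert b (Poly_Mapping.keys n) \<subseteq> Y"
          using N b by (auto simp: upset_def)
        then have "insert b (Poly_Mapping.keys n) \<in> N"
          using N mn(2) unfolding upset_def by blast
        then show "m + n \<in> {m. Poly_Mapping.keys m \<in> {F \<in> N. b \<in> F}}"
          using mn(1) by (simp add: keys_add_nat)
      qed
      then show "?x \<cdot> x \<in> ideal_vecs (sqfree {F \<in> N. b \<in> F})" using x by (simp add: ideal_vecs_def)
    qed
    show "ideal_vecs (sqfree {F \<in> N. b \<in> F}) \<subseteq> (\<lambda>x. ?x \<cdot> x) ` ?M"
    proof
      fix y :: "nat \<Rightarrow> ('v, 'k) mpoly" assume y: "y \<in> ideal_vecs (sqfree {F \<in> N. b \<in> F})"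
      define p where "p = Poly_Mapping.map_key ((+) ?m) (y 0)"
      have inj: "inj ((+) ?m)" by (simp add: inj_def)
      have lp: "Poly_Mapping.lookup p n = Poly_Mapping.lookup (y 0) (?m + n)" for n
        unfolding p_def map_key.rep_eq[OF inj] by simp
      have kp: "Poly_Mapping.keys n \<in> N" if "n \<in> Poly_Mapping.keys p" for n
      proof -
        have "?m + n \<in> Poly_Mapping.keys (y 0)" using that lp by (simp add: in_keys_iff)
        then have "Poly_Mapping.keys (?m + n) \<in> N"
          using y by (auto simp: ideal_vecs_def sqfree_def mons_in_def)
        moreover have "Poly_Mapping.keys (?m + n) = insert b (Poly_Mapping.keys n)"
          by (simp add: keys_add_nat)
        ultimately have *: "insert b (Poly_Mapping.keys n) \<in> N" "Poly_Mapping.keys n \<subseteq> Y"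
          using N by (auto simp: upset_def)
        have "insert b (Poly_Mapping.keys n) - {b} = Poly_Mapping.keys n - {b}" by blast
        then show ?thesis
          using inv[of "insert b (Poly_Mapping.keys n)"] inv[OF *(2)] * b by simp
      qed
      have "?x * p = y 0"
      proof (rule poly_mapping_eqI)
        fix k
        show "Poly_Mapping.lookup (?x * p) k = Poly_Mapping.lookup (y 0) k"
        proof (cases "\<exists>n. k = ?m + n")
          case True
          then show ?thesis using lookup_monom_mult[of ?m p] lp by (auto simp: var_def)
        next
          case False
          then have "k \<notin> Poly_Mapping.keys (?x * p)"
            using keys_mult[of ?x p] by (auto simp: var_def)
          moreover have "k \<notin> Poly_Mapping.keys (y 0)"
          proof
            assume "k \<in> Poly_Mapping.keys (y 0)"
            then have "b \<in> Poly_Mapping.keys k" using y by (auto simp: ideal_vecs_def sqfree_def mons_in_def)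
            then have "k = ?m + (k - ?m)"
              by (intro poly_mapping_eqI) (auto simp: lookup_add lookup_minus lookup_single when_def in_keys_iff)
            with False show False by blast
          qed
          ultimately show ?thesis by (simp add: in_keys_iff)
        qed
      qed
      then have "y = ?x \<cdot> (\<lambda>i. if i = 0 then p else 0)"
        using y by (auto simp: ideal_vecs_def fun_eq_iff)
      moreover have "(\<lambda>i. if i = 0 then p else 0) \<in> ?M"
        using kp by (auto simp: ideal_vecs_def sqfree_def mons_in_def)
      ultimately show "y \<in> (\<lambda>x. ?x \<cdot> x) ` ?M" by blast
    qed
  qed
  ultimately show ?thesis by simp
qed

section \<open>The zero ideal and the unit ideal\<close>

lemma free_vecs_0: "free_vecs Y 0 = {0}"
  by (auto simp: free_vecs_def fun_eq_iff)

lemma linear_zero: "linear_module Y q ({0} :: (nat \<Rightarrow> ('v, 'k::field) mpoly) set)"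
proof (coinduction arbitrary: q)
  case linear_module
  show ?case
    by (rule exI[of _ 0]) (auto simp: syz_def free_vecs_0)
qed

lemma linear_unit_ideal: "linear_module Y 0 (ideal_vecs (sqfree (Pow Y)) :: (nat \<Rightarrow> ('v, 'k::field) mpoly) set)"
proof -
  have "syz Y 1 unit_vec = {0 :: nat \<Rightarrow> ('v, 'k) mpoly}"
    using submod_zero[OF submod_free] by (auto simp: syz_def comb_unit_vecs)
  then have "linear_module Y 1 (syz Y 1 unit_vec :: (nat \<Rightarrow> ('v, 'k) mpoly) set)"
    using linear_zero[of Y 1] by simp
  then have "linear_module Y 0 (comb 1 unit_vec ` free_vecs Y 1 :: (nat \<Rightarrow> ('v, 'k) mpoly) set)"
    by (intro linear_moduleI unit_vec_hom)
  moreover have "comb 1 unit_vec ` free_vecs Y 1 = (free_vecs Y 1 :: (nat \<Rightarrow> ('v, 'k) mpoly) set)"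
    using comb_unit_vecs by force
  moreover have "free_vecs Y 1 = (ideal_vecs (sqfree (Pow Y)) :: (nat \<Rightarrow> ('v, 'k) mpoly) set)"
    by (auto simp: free_vecs_def ideal_vecs_def sqfree_def polys_eq Pow_def)
  ultimately show ?thesis by simp
qed

section \<open>Families of vertex sets that generate linear ideals\<close>

definition upgen :: "'v set \<Rightarrow> 'v set set \<Rightarrow> 'v set set" where
  "upgen Y \<S> = {F. F \<subseteq> Y \<and> (\<exists>S\<in>\<S>. S \<subseteq> F)}"

text \<open>
  Vertex sets do not determine the coefficient field; it is passed as a type.
\<close>

definition linear_family :: "'k::field itself \<Rightarrow> 'v set \<Rightarrow> nat \<Rightarrow> 'v set set \<Rightarrow> bool" where
  "linear_family _ Y q \<S> \<longleftrightarrow>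
    linear_module Y (int q) (ideal_vecs (sqfree (upgen Y \<S>)) :: (nat \<Rightarrow> ('v, 'k) mpoly) set)"

lemma upset_upgen: "upset Y (upgen Y \<S>)"
  by (auto simp: upset_def upgen_def)

lemma upgen_union: "upgen Y (\<S> \<union> \<T>) = upgen Y \<S> \<union> upgen Y \<T>"
  by (auto simp: upgen_def)

lemma upgen_insert: "upgen Y (insert b ` \<S>) = {F \<in> upgen Y \<S>. b \<in> F}"
  by (auto simp: upgen_def)

lemma linear_family_insert:
  assumes "linear_family TYPE('k::field) Y q \<S>" "b \<in> Y" "\<And>S. S \<in> \<S> \<Longrightarrow> b \<notin> S"
  shows "linear_family TYPE('k::field) Y (Suc q) (insert b ` \<S>)"
proof -
  have "F \<in> upgen Y \<S> \<longleftrightarrow> F - {b} \<in> upgen Y \<S>" if "F \<subseteq> Y" for F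
  proof -
    have "S \<subseteq> F - {b} \<longleftrightarrow> S \<subseteq> F" if "S \<in> \<S>" for S
      using assms(3)[OF that] by blast
    then show ?thesis using that by (auto simp: upgen_def)
  qed
  from linear_shift[OF upset_upgen assms(2) this, of "int q", where 'k = 'k] assms(1)
  show ?thesis by (simp add: linear_family_def upgen_insert add.commute)
qed

text \<open>
  The families generate ideals \<open>I \<subseteq> J\<close> with generators that do not involve the variable \<open>x\<close> of \<open>b\<close>,
  and so \<open>I \<inter> x J = x I\<close>.  Thus the Mayer-Vietoris sequence of \<open>I\<close> and \<open>x J\<close> starts with a module that is
  linear one degree higher.
\<close>

lemma linear_family_glue:
  assumes S: "linear_family TYPE('k::field) Y (Suc q) \<S>" and T: "linear_family TYPE('k::field) Y q \<T>"
    and b: "b \<in> Y" "\<And>S. S \<in> \<S> \<Longrightarrow> b \<notin> S" "\<And>T. T \<in> \<T> \<Longrightarrow> b \<notin> T"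
    and refine: "\<And>S. S \<in> \<S> \<Longrightarrow> \<exists>T\<in>\<T>. T \<subseteq> S"
  shows "linear_family TYPE('k::field) Y (Suc q) (\<S> \<union> insert b ` \<T>)"
proof -
  have "upgen Y \<S> \<inter> upgen Y (insert b ` \<T>) = upgen Y (insert b ` \<S>)"
    unfolding upgen_insert
  proof (intro equalityI subsetI)
    fix F assume F: "F \<in> {F \<in> upgen Y \<S>. b \<in> F}"
    then obtain S where "F \<subseteq> Y" "b \<in> F" "S \<in> \<S>" "S \<subseteq> F" by (auto simp: upgen_def)
    moreover then obtain T where "T \<in> \<T>" "T \<subseteq> S" using refine by blast
    ultimately show "F \<in> upgen Y \<S> \<inter> {F \<in> upgen Y \<T>. b \<in> F}" by (auto simp: upgen_def)
  qed simp
  then show ?thesis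
    using linear_union[OF upset_upgen[of Y \<S>] upset_upgen[of Y "insert b ` \<T>"], of "int (Suc q)"]
      linear_family_insert[OF S b(1,2)] linear_family_insert[OF T b(1,3)] S
    by (simp add: linear_family_def upgen_union add.commute)
qed

lemma linear_family_empty:
  fixes Y :: "'v set"
  shows "linear_family TYPE('k::field) Y q {}"
proof -
  have "ideal_vecs (sqfree {}) = {0 :: nat \<Rightarrow> ('v, 'k) mpoly}"
    by (auto simp: ideal_vecs_def sqfree_def mons_in_def fun_eq_iff) (metis gr0I)
  then show ?thesis using linear_zero by (simp add: linear_family_def upgen_def)
qed

lemma nsets_0: "nsets Z 0 = {{}}"
  by (auto simp: nsets_def)

lemma nsets_insert:
  assumes "b \<notin> Z"
  shows "nsets (insert b Z) (Suc e) = nsets Z (Suc e) \<union> insert b ` nsets Z e"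
proof
  show "nsets (insert b Z) (Suc e) \<subseteq> nsets Z (Suc e) \<union> insert b ` nsets Z e"
  proof
    fix S assume S: "S \<in> nsets (insert b Z) (Suc e)"
    show "S \<in> nsets Z (Suc e) \<union> insert b ` nsets Z e"
    proof (cases "b \<in> S")
      case True
      then have "S = insert b (S - {b})" "S - {b} \<in> nsets Z e"
        using S by (auto simp: nsets_def)
      then show ?thesis by blast
    qed (use S in \<open>auto simp: nsets_def\<close>)
  qed
  show "nsets Z (Suc e) \<union> insert b ` nsets Z e \<subseteq> nsets (insert b Z) (Suc e)"
    using assms by (auto simp: nsets_def card_insert_if)
qed

lemma nsets_Suc_contains:
  assumes "S \<in> nsets Z (Suc e)"
  shows "\<exists>T\<in>nsets Z e. T \<subseteq> S"
proof -
  have "S \<noteq> {}" using assms by (auto simp: nsets_def)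
  then obtain v where "v \<in> S" by blast
  then have "S - {v} \<in> nsets Z e" using assms by (auto simp: nsets_def)
  then show ?thesis by blast
qed

text \<open>
  The \<open>e\<close>-subsets of \<open>Z \<union> {b}\<close> are those of \<open>Z\<close> and those obtained by adding \<open>b\<close> to an
  \<open>(e - 1)\<close>-subset of \<open>Z\<close>.
\<close>

lemma linear_family_nsets:
  assumes "finite Z" "Z \<subseteq> Y"
  shows "linear_family TYPE('k::field) Y e (nsets Z e)"
  using assms
proof (induction Z arbitrary: e rule: finite_induct)
  case empty
  show ?case
  proof (cases e)
    case 0
    then show ?thesis using linear_unit_ideal by (simp add: linear_family_def nsets_0 upgen_def Pow_def)
  next
    case (Suc e')
    then have "nsets {} e = {}" by (auto simp: nsets_def)
    then show ?thesis using linear_family_empty by metis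
  qed
next
  case (insert b Z)
  show ?case
  proof (cases e)
    case 0
    then show ?thesis using linear_unit_ideal by (simp add: linear_family_def nsets_0 upgen_def Pow_def)
  next
    case (Suc e')
    show ?thesis unfolding Suc nsets_insert[OF insert.hyps(2)]
      using insert by (intro linear_family_glue nsets_Suc_contains) (auto simp: nsets_def)
  qed
qed

text \<open>
  Adding the vertices of \<open>Z\<close> to \<open>A\<close> one at a time, each new vertex \<open>b\<close> contributes the sets obtained by
  adding \<open>b\<close> to an arbitrary \<open>(e - 1)\<close>-subset of the earlier vertices.
\<close>

lemma linear_family_nsets_outside:
  assumes "finite Z" "A \<union> Z \<subseteq> Y" "finite A"
  shows "linear_family TYPE('k::field) Y e (nsets (A \<union> Z) e - nsets A e)"
  using assms
proof (induction Z rule: finite_induct)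
  case empty
  then show ?case using linear_family_empty by simp
next
  case (insert b Z)
  show ?case
  proof (cases "b \<in> A")
    case True
    then show ?thesis using insert by (simp add: insert_absorb)
  next
    case False
    then have b: "b \<notin> A \<union> Z" using insert.hyps by blast
    show ?thesis
    proof (cases e)
      case 0
      then show ?thesis using linear_family_empty by (simp add: nsets_0)
    next
      case (Suc e')
      have "nsets (A \<union> insert b Z) e - nsets A e =
          (nsets (A \<union> Z) e - nsets A e) \<union> insert b ` nsets (A \<union> Z) e'"
        using nsets_insert[OF b, of e'] False unfolding Suc by (auto simp: nsets_def)
      moreover have "linear_family TYPE('k::field) Y e
          ((nsets (A \<union> Z) e - nsets A e) \<union> insert b ` nsets (A \<union> Z) e')"
        unfolding Suc
      proof (rule linear_family_glue)
        show "linear_family TYPE('k) Y e' (nsets (A \<union> Z) e')"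
          using insert by (intro linear_family_nsets) auto
        show "\<exists>T\<in>nsets (A \<union> Z) e'. T \<subseteq> S" if "S \<in> nsets (A \<union> Z) (Suc e') - nsets A (Suc e')" for S
          using that by (intro nsets_Suc_contains) blast
      qed (use insert b Suc in \<open>auto simp: nsets_def\<close>)
      ultimately show ?thesis by simp
    qed
  qed
qed

section \<open>The two construction steps of generalized chordal hypergraphs\<close>

text \<open>
  Gluing the complete hypergraph on \<open>A \<union> {b}\<close> along \<open>A\<close> creates exactly the non-edges \<open>S \<union> {b}\<close> where
  \<open>S\<close> is a \<open>(d - 1)\<close>-subset of \<open>X\<close> not contained in \<open>A\<close>.  Every old non-edge contains such an \<open>S\<close>, because
  it is not contained in \<open>A\<close> itself.
\<close>

lemma linear_family_glue_vertex:
  assumes lin: "linear_family TYPE('k::field) Y d (nsets X d - E)"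
    and d: "2 \<le> d" and X: "finite X" "insert b X \<subseteq> Y" "b \<notin> X"
    and A: "A \<subseteq> X" "nsets A d \<subseteq> E" and E: "E \<subseteq> nsets X d"
  shows "linear_family TYPE('k::field) Y d (nsets (insert b X) d - (E \<union> nsets (insert b A) d))"
proof -
  obtain e where e: "d = Suc e" "1 \<le> e" using d by (cases d) auto
  have "nsets (insert b X) d - (E \<union> nsets (insert b A) d) =
      (nsets X d - E) \<union> insert b ` (nsets X e - nsets A e)"
  proof -
    have bA: "b \<notin> A" using A X by blast
    have "inj_on (insert b) (nsets X e)"
      using X(3) by (auto simp: inj_on_def nsets_def)
    moreover have AX: "nsets A e \<subseteq> nsets X e" using A(1) by (auto simp: nsets_def)
    ultimately have "insert b ` (nsets X e - nsets A e) = insert b ` nsets X e - insert b ` nsets A e"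
      by (intro inj_on_image_set_diff) auto
    moreover have "insert b ` nsets X e \<inter> nsets X d = {}" using X by (auto simp: nsets_def)
    moreover have "insert b ` nsets A e \<subseteq> insert b ` nsets X e" using AX by (rule image_mono)
    moreover have "(NX \<union> P) - (E \<union> (NA \<union> Q)) = (NX - E) \<union> (P - Q)"
      if "P \<inter> NX = {}" "Q \<subseteq> P" "NA \<subseteq> E" "E \<subseteq> NX" for P Q NX NA
      using that by blast
    ultimately show ?thesis
      using A(2) E unfolding e(1) nsets_insert[OF X(3)] nsets_insert[OF bA] by metis
  qed
  moreover have "linear_family TYPE('k::field) Y (Suc e) ((nsets X d - E) \<union> insert b ` (nsets X e - nsets A e))"
  proof (rule linear_family_glue)
    show "linear_family TYPE('k) Y (Suc e) (nsets X d - E)" using lin e by simp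
    have "A \<union> (X - A) = X" using A by blast
    then show "linear_family TYPE('k) Y e (nsets X e - nsets A e)"
      using linear_family_nsets_outside[of "X - A" A Y e, where 'k = 'k] X A
      by (auto intro: finite_subset)
    fix S assume S: "S \<in> nsets X d - E"
    then have "\<not> S \<subseteq> A" using A(2) by (auto simp: nsets_def)
    then obtain v where v: "v \<in> S" "v \<notin> A" by blast
    \<comment> \<open>Here \<open>d \<ge> 2\<close> is essential: an element other than \<open>v\<close> can be removed.\<close>
    have "S \<noteq> {v}" using S e by (auto simp: nsets_def)
    then obtain u where u: "u \<in> S" "u \<noteq> v" using v(1) by blast
    have "S - {u} \<in> nsets X e - nsets A e" using S u v e by (auto simp: nsets_def)
    then show "\<exists>T\<in>nsets X e - nsets A e. T \<subseteq> S" by blast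
  qed (use X in \<open>auto simp: nsets_def\<close>)
  ultimately show ?thesis using e by simp
qed

text \<open>
  The ideal is the product of the monomial of \<open>S\<close> with an ideal generated by variables.
\<close>

lemma linear_family_star:
  assumes "finite S" "finite W" "S \<inter> W = {}" "S \<union> W \<subseteq> Y"
  shows "linear_family TYPE('k::field) Y (Suc (card S)) ((\<lambda>w. insert w S) ` W)"
  using assms
proof (induction S rule: finite_induct)
  case empty
  have "nsets W 1 = (\<lambda>w. {w}) ` W" by (auto simp: nsets_def card_1_singleton_iff)
  then show ?case using linear_family_nsets[of W Y 1, where 'k = 'k] empty by simp
next
  case (insert b S)
  have "(\<lambda>w. insert w (insert b S)) ` W = insert b ` (\<lambda>w. insert w S) ` W"
    by (auto simp: image_image insert_commute)
  moreover have "linear_family TYPE('k::field) Y (Suc (Suc (card S))) (insert b ` (\<lambda>w. insert w S) ` W)"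
    using insert by (intro linear_family_insert) auto
  ultimately show ?case using insert.hyps by simp
qed

text \<open>
  Let \<open>I'\<close> and \<open>I\<close> be the ideals of the non-edges with and without the new edge \<open>e\<close>, and let \<open>L\<close> be
  generated by the sets \<open>S \<union> {w}\<close> with \<open>w \<in> X - S\<close>.  As \<open>S\<close> lies in no edge, all these sets are
  non-edges before \<open>e\<close> is added, and \<open>e\<close> is one of them; so \<open>I' + L = I\<close>.  A set containing \<open>S\<close> and a
  non-edge other than \<open>e\<close> contains a vertex outside \<open>e\<close>, so \<open>I' \<inter> L\<close> is generated by the sets
  \<open>S \<union> {w}\<close> with \<open>w \<in> X - e\<close>.  Both ends of the Mayer-Vietoris sequence of \<open>I'\<close> and \<open>L\<close> are thus linear
  in degree \<open>d\<close>, hence so is the summand \<open>I'\<close> of its middle term.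
\<close>

lemma linear_family_add_edge:
  assumes lin: "linear_family TYPE('k::field) Y d (nsets X d - E)"
    and d: "2 \<le> d" and X: "finite X" "X \<subseteq> Y"
    and e: "e \<in> nsets X d" and S: "S \<in> nsets e (d - 1)" "\<forall>e'\<in>E. \<not> S \<subseteq> e'"
  shows "linear_family TYPE('k::field) Y d (nsets X d - insert e E)"
proof -
  have fS: "finite S" "card S = d - 1" "S \<subseteq> e" "S \<subseteq> X" and fe: "finite e" "card e = d" "e \<subseteq> X"
    using S e by (auto simp: nsets_def)
  let ?star = "\<lambda>W. (\<lambda>w. insert w S) ` W"
  let ?G = "nsets X d - insert e E"
  have star: "linear_family TYPE('k) Y d (?star W)" if "W \<subseteq> X - S" for W
  proof -
    have "finite W" using that X by (meson finite_Diff finite_subset)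
    then show ?thesis
      using linear_family_star[of S W Y, where 'k = 'k] that fS X d by auto
  qed
  have star_edge: "insert w S \<in> nsets X d - E" if "w \<in> X - S" for w
    using that fS S(2) d by (auto simp: nsets_def)
  have "?G \<union> ?star (X - S) = nsets X d - E"
  proof
    show "?G \<union> ?star (X - S) \<subseteq> nsets X d - E" using star_edge by auto
    have "card (e - S) = 1" using fS fe d by (simp add: card_Diff_subset)
    then obtain v where "e - S = {v}" by (auto simp: card_1_singleton_iff)
    then have "v \<in> X - S" "e = insert v S" using fS fe by blast+
    then show "nsets X d - E \<subseteq> ?G \<union> ?star (X - S)" by blast
  qed
  then have un: "upgen Y ?G \<union> upgen Y (?star (X - S)) = upgen Y (nsets X d - E)"
    by (metis upgen_union)
  have int: "upgen Y ?G \<inter> upgen Y (?star (X - S)) = upgen Y (?star (X - e))"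
  proof
    show "upgen Y ?G \<inter> upgen Y (?star (X - S)) \<subseteq> upgen Y (?star (X - e))"
    proof
      fix F assume F: "F \<in> upgen Y ?G \<inter> upgen Y (?star (X - S))"
      then obtain f where f: "f \<in> nsets X d" "f \<noteq> e" "f \<subseteq> F" by (auto simp: upgen_def)
      have "\<not> f \<subseteq> e" using f(1,2) fe(2) card_subset_eq[OF fe(1), of f] by (auto simp: nsets_def)
      then obtain w where "w \<in> f" "w \<notin> e" by blast
      then have "w \<in> X - e" "insert w S \<subseteq> F" using f F by (auto simp: nsets_def upgen_def)
      then show "F \<in> upgen Y (?star (X - e))" using F by (auto simp: upgen_def)
    qed
    show "upgen Y (?star (X - e)) \<subseteq> upgen Y ?G \<inter> upgen Y (?star (X - S))"
    proof
      fix F assume "F \<in> upgen Y (?star (X - e))"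
      then obtain w where w: "w \<in> X - e" "insert w S \<subseteq> F" "F \<subseteq> Y" by (auto simp: upgen_def)
      then have "w \<in> X - S" using fS by blast
      moreover from this have "insert w S \<in> ?G" using star_edge[of w] w(1) by auto
      ultimately show "F \<in> upgen Y ?G \<inter> upgen Y (?star (X - S))"
        using w(2,3) unfolding upgen_def by blast
    qed
  qed
  have "linear_family TYPE('k) Y d (?star (X - e))" using fS by (intro star) blast
  with lin show ?thesis
    unfolding linear_family_def
    by (intro linear_inter_union_imp_left[OF upset_upgen[of Y ?G] upset_upgen[of Y "?star (X - S)"]])
      (simp_all only: un int)
qed

text \<open>
  The polynomial ring has to be fixed while vertices are added, so the ideal of the non-edges is
  taken in the variables of a larger vertex set \<open>Y\<close>.
\<close>

lemma generalized_chordal_linear: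
  assumes "generalized_chordal d X E" "2 \<le> d" "X \<subseteq> Y"
  shows "linear_family TYPE('k::field) Y d (nsets X d - E)"
  using assms
proof (induction rule: generalized_chordal.induct)
  case (complete X)
  then show ?case using linear_family_empty by simp
next
  case (glue X E A B)
  note unif = generalized_chordal_uniform[OF glue.hyps(1)]
  \<comment> \<open>The new vertices are glued one at a time, each along \<open>A\<close> and the vertices of \<open>B\<close> before it.\<close>
  have "linear_family TYPE('k) Y d (nsets (X \<union> B) d - (E \<union> nsets (A \<union> B) d)) \<and>
      E \<union> nsets (A \<union> B) d \<subseteq> nsets (X \<union> B) d"
    using glue.hyps(4) glue.prems(2) glue.hyps(6)
  proof (induction B rule: finite_induct)
    case empty
    have "E \<union> nsets A d = E" using glue.hyps(3) by blast
    then show ?case using glue unif by simp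
  next
    case (insert b B)
    let ?E = "E \<union> nsets (A \<union> B) d"
    have IH: "linear_family TYPE('k) Y d (nsets (X \<union> B) d - ?E)" "?E \<subseteq> nsets (X \<union> B) d"
      using insert by auto
    have "linear_family TYPE('k) Y d
        (nsets (insert b (X \<union> B)) d - (?E \<union> nsets (insert b (A \<union> B)) d))"
      using insert glue.hyps(2) unif(1) IH glue.prems(1)
      by (intro linear_family_glue_vertex) auto
    moreover have "?E \<union> nsets (insert b (A \<union> B)) d = E \<union> nsets (A \<union> insert b B) d"
      by (auto simp: nsets_def)
    moreover have "E \<union> nsets (A \<union> insert b B) d \<subseteq> nsets (X \<union> insert b B) d"
    proof -
      have "nsets X d \<subseteq> nsets (X \<union> insert b B) d" by (rule nsets_mono) auto
      moreover have "nsets (A \<union> insert b B) d \<subseteq> nsets (X \<union> insert b B) d"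
        using glue.hyps(2) by (intro nsets_mono) blast
      ultimately show ?thesis using unif(2) by simp
    qed
    ultimately show ?case by simp
  qed
  then show ?case by blast
next
  case (add_edge X E e)
  then obtain S where "S \<in> nsets e (d - 1)" "\<forall>e'\<in>E. \<not> S \<subseteq> e'" by blast
  then show ?case
    using add_edge generalized_chordal_uniform[OF add_edge.hyps(1)]
    by (intro linear_family_add_edge) auto
qed

section \<open>The polynomial ring and its quotients\<close>

lemma poly_ring_simps:
  "mult (poly_ring Y) = (*)" "one (poly_ring Y) = 1" "zero (poly_ring Y) = 0" "add (poly_ring Y) = (+)"
  by (simp_all add: poly_ring_def)

lemma cring_poly_ring: "cring (poly_ring Y :: ('v, 'k::field) mpoly ring)"
proof (rule cringI)
  show "abelian_group (poly_ring Y :: ('v, 'k) mpoly ring)"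
  proof (rule abelian_groupI)
    fix x :: "('v, 'k) mpoly" assume "x \<in> carrier (poly_ring Y)"
    then show "\<exists>y\<in>carrier (poly_ring Y). y \<oplus>\<^bsub>poly_ring Y\<^esub> x = \<zero>\<^bsub>poly_ring Y\<^esub>"
      by (intro bexI[of _ "- x"]) (auto simp: poly_ring_simps)
  qed (auto simp: poly_ring_simps algebra_simps)
  show "comm_monoid (poly_ring Y :: ('v, 'k) mpoly ring)"
    by (rule comm_monoidI) (auto simp: poly_ring_simps algebra_simps)
qed (auto simp: poly_ring_simps algebra_simps)

lemma poly_ring_a_inv:
  assumes "x \<in> polys Y"
  shows "\<ominus>\<^bsub>poly_ring Y\<^esub> x = - x"
proof -
  interpret cring "poly_ring Y" by (rule cring_poly_ring)
  have "- x \<oplus>\<^bsub>poly_ring Y\<^esub> x = \<zero>\<^bsub>poly_ring Y\<^esub>" by (simp add: poly_ring_simps)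
  then show ?thesis using assms by (intro minus_equality) auto
qed

lemma ideal_poly_ringI:
  fixes I :: "('v, 'k::field) mpoly set"
  assumes "I \<subseteq> polys Y" "0 \<in> I" "\<And>p q. p \<in> I \<Longrightarrow> q \<in> I \<Longrightarrow> p + q \<in> I"
    "\<And>p q. p \<in> polys Y \<Longrightarrow> q \<in> I \<Longrightarrow> p * q \<in> I"
  shows "ideal I (poly_ring Y)"
proof (rule idealI)
  interpret cring "poly_ring Y :: ('v, 'k) mpoly ring" by (rule cring_poly_ring)
  show "ring (poly_ring Y :: ('v, 'k) mpoly ring)" by (rule ring_axioms)
  show "subgroup I (add_monoid (poly_ring Y))"
  proof (rule add.subgroupI)
    fix a assume a: "a \<in> I"
    then have "- a = - 1 * a" by simp
    then have "- a \<in> I" using assms(4)[of "- 1" a] a by (simp add: polys_uminus)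
    then show "\<ominus>\<^bsub>poly_ring Y\<^esub> a \<in> I" using a assms(1) by (subst poly_ring_a_inv) auto
  qed (use assms in \<open>auto simp: poly_ring_simps\<close>)
  fix a x :: "('v, 'k) mpoly" assume "a \<in> I" "x \<in> carrier (poly_ring Y)"
  then show "x \<otimes>\<^bsub>poly_ring Y\<^esub> a \<in> I" "a \<otimes>\<^bsub>poly_ring Y\<^esub> x \<in> I"
    using assms(4)[of x a] by (simp_all add: poly_ring_simps mult.commute)
qed

lemma ideal_poly_ringD:
  fixes I :: "('v, 'k::field) mpoly set"
  assumes "ideal I (poly_ring Y)"
  shows "I \<subseteq> polys Y" "0 \<in> I" "p \<in> I \<Longrightarrow> q \<in> I \<Longrightarrow> p + q \<in> I"
    "p \<in> polys Y \<Longrightarrow> q \<in> I \<Longrightarrow> p * q \<in> I"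
proof -
  interpret ideal I "poly_ring Y" by fact
  show "I \<subseteq> polys Y" by (rule a_subset)
  show "0 \<in> I" using additive_subgroup.zero_closed[OF is_additive_subgroup] by (simp add: poly_ring_simps)
  show "p + q \<in> I" if "p \<in> I" "q \<in> I" using additive_subgroup.a_closed[OF is_additive_subgroup that] by (simp add: poly_ring_simps)
  show "p * q \<in> I" if "p \<in> polys Y" "q \<in> I" using I_l_closed[OF that(2,1)] by (simp add: poly_ring_simps)
qed

lemma ideal_sqfree:
  assumes "upset Y N"
  shows "ideal (sqfree N) (poly_ring Y)"
proof (rule ideal_poly_ringI)
  show "sqfree N \<subseteq> polys Y"
    using assms by (auto simp: sqfree_def polys_eq mons_in_def upset_def)
qed (auto simp: sqfree_add sqfree_mult[OF assms])

lemma prod_var: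
  assumes "finite F"
  shows "(\<Prod>v\<in>F. var v :: ('v, 'k::field) mpoly) = Poly_Mapping.single (\<Sum>v\<in>F. Poly_Mapping.single v 1) 1"
  using assms by (induction F) (simp_all add: var_def mult_single)

lemma lookup_sum_single:
  "finite F \<Longrightarrow> Poly_Mapping.lookup (\<Sum>v\<in>F. Poly_Mapping.single v (Suc 0)) u = (if u \<in> F then 1 else 0)"
  by (simp add: lookup_sum lookup_single when_def)

lemma sum_of_terms:
  "p = (\<Sum>m\<in>Poly_Mapping.keys p. Poly_Mapping.single m (Poly_Mapping.lookup p m))"
  by (rule poly_mapping_eqI) (auto simp: lookup_sum lookup_single when_def in_keys_iff)

text \<open>
  A monomial with support \<open>F\<close> is a multiple of the product of the variables in \<open>F\<close>, so every
  polynomial whose monomials are supported on non-faces lies in the ideal generated by the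
  squarefree monomials of non-faces.
\<close>

lemma stanley_reisner_ideal_eq_sqfree:
  fixes \<Delta> :: "'v set set"
  assumes up: "upset Y (Pow Y - \<Delta>)" and fin: "finite Y"
  shows "stanley_reisner_ideal Y \<Delta> = (sqfree (Pow Y - \<Delta>) :: ('v, 'k::field) mpoly set)"
proof -
  let ?R = "poly_ring Y :: ('v, 'k) mpoly ring"
  let ?G = "{\<Prod>v\<in>F. var v | F. F \<subseteq> Y \<and> F \<notin> \<Delta>} :: ('v, 'k) mpoly set"
  let ?J = "genideal ?R ?G"
  let ?N = "Pow Y - \<Delta>"
  interpret cring ?R by (rule cring_poly_ring)
  have keys_ind: "Poly_Mapping.keys (\<Sum>v\<in>F. Poly_Mapping.single v (1::nat)) = F" if "F \<subseteq> Y" for F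
    using lookup_sum_single[of F] finite_subset[OF that fin] by (auto simp: in_keys_iff split: if_splits)
  have G: "?G \<subseteq> sqfree ?N"
  proof
    fix p assume "p \<in> ?G"
    then obtain F where F: "F \<subseteq> Y" "F \<notin> \<Delta>" "p = (\<Prod>v\<in>F. var v)" by blast
    then have "p = Poly_Mapping.single (\<Sum>v\<in>F. Poly_Mapping.single v 1) 1"
      using prod_var[OF finite_subset[OF F(1) fin]] by simp
    then show "p \<in> sqfree ?N"
      using F keys_ind[OF F(1)] by (simp add: sqfree_def mons_in_def)
  qed
  have "sqfree ?N \<subseteq> polys Y" by (rule ideal_poly_ringD(1)[OF ideal_sqfree[OF up]])
  with G have GR: "?G \<subseteq> carrier ?R" by blast
  note J = ideal_poly_ringD[OF genideal_ideal[OF GR]]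
  have "?J \<subseteq> sqfree ?N" by (rule genideal_minimal[OF ideal_sqfree[OF up] G])
  moreover have "sqfree ?N \<subseteq> ?J"
  proof
    fix p :: "('v, 'k) mpoly" assume p: "p \<in> sqfree ?N"
    have monomial: "Poly_Mapping.single m c \<in> ?J" if m: "m \<in> Poly_Mapping.keys p" for m c
    proof -
      let ?F = "Poly_Mapping.keys m"
      let ?s = "\<Sum>v\<in>?F. Poly_Mapping.single v (1::nat)"
      have F: "?F \<subseteq> Y" "?F \<notin> \<Delta>" using p m by (auto simp: sqfree_def mons_in_def)
      have "(m - ?s) + ?s = m"
        by (rule poly_mapping_eqI)
          (simp add: lookup_add lookup_minus lookup_sum_single in_keys_iff)
      then have "Poly_Mapping.single m c = Poly_Mapping.single (m - ?s) c * (\<Prod>v\<in>?F. var v)"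
        by (simp add: prod_var mult_single)
      moreover have "(\<Prod>v\<in>?F. var v) \<in> ?J"
        by (rule subsetD[OF genideal_self[OF GR]]) (use F in blast)
      moreover have "Poly_Mapping.keys (m - ?s) \<subseteq> ?F"
        by (auto simp: in_keys_iff lookup_minus)
      then have "Poly_Mapping.single (m - ?s) c \<in> polys Y"
        using F(1) by (auto simp: polys_eq mons_in_def)
      ultimately show ?thesis using J(4) by simp
    qed
    have "(\<Sum>m\<in>K. Poly_Mapping.single m (Poly_Mapping.lookup p m)) \<in> ?J"
      if "K \<subseteq> Poly_Mapping.keys p" for K
      using finite_subset[OF that finite_keys] that
      by (induction K rule: finite_induct) (auto intro: J(2,3) monomial)
    from this[OF order_refl] show "p \<in> ?J" by (simp only: sum_of_terms[symmetric])
  qed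
  ultimately show ?thesis unfolding stanley_reisner_ideal_def by blast
qed

lemma quotient_module_simps:
  fixes I :: "('v, 'k::field) mpoly set"
  assumes "ideal I (poly_ring Y)"
  defines "cl \<equiv> (\<lambda>p. I +>\<^bsub>poly_ring Y\<^esub> p)"
  shows "carrier (quotient_module Y I) = cl ` polys Y"
    and "p \<in> polys Y \<Longrightarrow> q \<in> polys Y \<Longrightarrow> cl p \<oplus>\<^bsub>quotient_module Y I\<^esub> cl q = cl (p + q)"
    and "p \<in> polys Y \<Longrightarrow> q \<in> polys Y \<Longrightarrow> p \<odot>\<^bsub>quotient_module Y I\<^esub> cl q = cl (p * q)"
    and "component (quotient_module Y I) j = cl ` homogeneous Y j"
    and "p \<in> polys Y \<Longrightarrow> cl p = \<zero>\<^bsub>quotient_module Y I\<^esub> \<longleftrightarrow> p \<in> I"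
proof -
  interpret ideal I "poly_ring Y" by fact
  show "carrier (quotient_module Y I) = cl ` polys Y"
    by (auto simp: quotient_module_def ring.defs FactRing_def A_RCOSETS_def' cl_def)
  show "cl p \<oplus>\<^bsub>quotient_module Y I\<^esub> cl q = cl (p + q)" if "p \<in> polys Y" "q \<in> polys Y"
    using a_rcos_sum[OF that] by (simp add: quotient_module_def ring.defs FactRing_def cl_def poly_ring_simps)
  show "p \<odot>\<^bsub>quotient_module Y I\<^esub> cl q = cl (p * q)" if "p \<in> polys Y" "q \<in> polys Y"
    using rcoset_mult_add[OF that] by (simp add: quotient_module_def ring.defs FactRing_def cl_def poly_ring_simps)
  show "component (quotient_module Y I) j = cl ` homogeneous Y j"
    by (simp add: quotient_module_def ring.defs cl_def)
  have z: "\<zero>\<^bsub>quotient_module Y I\<^esub> = I"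
    by (simp add: quotient_module_def ring.defs FactRing_def)
  show "cl p = \<zero>\<^bsub>quotient_module Y I\<^esub> \<longleftrightarrow> p \<in> I" if "p \<in> polys Y"
    unfolding z cl_def
    using a_rcos_self[OF that] a_rcos_const by auto
qed

lemma graded_free_simps:
  "carrier (graded_free Y a) = free_vecs Y (length a)"
  "zero (graded_free Y a) = 0"
  "x \<oplus>\<^bsub>graded_free Y a\<^esub> y = x + y"
  "p \<odot>\<^bsub>graded_free Y a\<^esub> x = p \<cdot> x"
  "component (graded_free Y a) j =
    {x. (\<forall>b<length a. x b \<in> homogeneous Y (j - a ! b)) \<and> (\<forall>b\<ge>length a. x b = 0)}"
  by (simp_all add: graded_free_def free_vecs_def fun_eq_iff)

section \<open>Existence of a linear resolution\<close>

lemma free_vecs_1_iff: "x \<in> free_vecs Y (Suc 0) \<longleftrightarrow> x 0 \<in> polys Y \<and> (\<forall>i>0. x i = 0)"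
  by (auto simp: free_vecs_def Suc_le_eq)

lemma comb_irrelevant:
  assumes "\<And>i. i < n \<Longrightarrow> g i \<in> hom_vecs Y q" "q \<noteq> 0" "x \<in> free_vecs Y n"
  shows "comb n g x b \<in> irrelevant_ideal Y"
proof -
  have "(\<Sum>i\<in>I. x i * g i b) \<in> irrelevant_ideal Y" if "I \<subseteq> {..<n}" for I
    using that
  proof (induction I rule: infinite_finite_induct)
    case (insert i I)
    have "g i b \<in> irrelevant_ideal Y"
      using assms(1,2) insert.prems by (intro homogeneous_irrelevant[of _ Y q]) (auto simp: hom_vecs_def)
    then have "x i * g i b \<in> irrelevant_ideal Y"
      using irrelevant_mult[of "g i b" Y "x i"] free_vecs_polys[OF assms(3)] by (simp add: mult.commute)
    with insert show ?case by (auto intro: irrelevant_add)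
  qed (auto simp: irrelevant_zero)
  then show ?thesis by (simp add: comb_def sum_apply)
qed

text \<open>
  Choosing generators again and again as in the definition of \<open>linear_module\<close> yields the free modules
  and the differentials, which map a basis vector to the corresponding generator.  The differentials are minimal because all
  generators have positive degree.
\<close>

lemma linear_resolution_exists:
  fixes I :: "('v, 'k::field) mpoly set"
  assumes I: "ideal I (poly_ring Y)" and lin: "linear_module Y (int d) (ideal_vecs I)" and d: "1 \<le> d"
  shows "\<exists>a \<delta> \<epsilon>. minimal_graded_free_resolution Y (quotient_module Y I) a \<delta> \<epsilon> \<and>
    (\<forall>i. set (a (Suc i)) \<subseteq> {int (d + i)})"
proof -
  let ?q = "\<lambda>i::nat. if i = 0 then int d else 1"
  let ?P = "\<lambda>i (n, g :: nat \<Rightarrow> nat \<Rightarrow> ('v, 'k) mpoly). (\<forall>b<n. g b \<in> hom_vecs Y (?q i)) \<and>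
      linear_module Y 1 (syz Y n g) \<and> (i = 0 \<longrightarrow> ideal_vecs I = comb n g ` free_vecs Y n)"
  let ?Q = "\<lambda>(n, g) (n', g'). syz Y n g = comb n' g' ` free_vecs Y n'"
  have "\<exists>s. \<forall>i. ?P i (s i) \<and> ?Q (s i) (s (Suc i))"
  proof (rule dependent_nat_choice[where P = ?P and Q = "\<lambda>_. ?Q"])
    from lin show "\<exists>x. ?P 0 x"
    proof (rule linear_moduleE)
      fix n and g :: "nat \<Rightarrow> nat \<Rightarrow> ('v, 'k) mpoly"
      assume "\<And>i. i < n \<Longrightarrow> g i \<in> hom_vecs Y (int d)" "ideal_vecs I = comb n g ` free_vecs Y n"
        "linear_module Y 1 (syz Y n g)"
      then show ?thesis by (intro exI[of _ "(n, g)"]) simp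
    qed
    fix x i assume x: "?P i x"
    obtain n g where ng: "x = (n, g)" by (cases x)
    from x have "linear_module Y 1 (syz Y n g)" by (simp add: ng)
    then show "\<exists>y. ?P (Suc i) y \<and> ?Q x y"
    proof (rule linear_moduleE)
      fix n' and g' :: "nat \<Rightarrow> nat \<Rightarrow> ('v, 'k) mpoly"
      assume "\<And>i. i < n' \<Longrightarrow> g' i \<in> hom_vecs Y 1" "syz Y n g = comb n' g' ` free_vecs Y n'"
        "linear_module Y 1 (syz Y n' g')"
      then show ?thesis by (intro exI[of _ "(n', g')"]) (simp add: ng)
    qed
  qed
  then obtain s where s: "\<forall>i. ?P i (s i) \<and> ?Q (s i) (s (Suc i))" by (rule exE)
  define n where "n i = fst (s i)" for i
  define g where "g i = snd (s i)" for i
  have sng: "s i = (n i, g i)" for i by (simp add: n_def g_def)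
  have ghom: "g i b \<in> hom_vecs Y (?q i)" if "b < n i" for i b
    using s[THEN spec, of i] that unfolding sng by auto
  have vecI: "ideal_vecs I = comb (n 0) (g 0) ` free_vecs Y (n 0)"
    using s[THEN spec, of 0] unfolding sng by auto
  have syzn: "syz Y (n i) (g i) = comb (n (Suc i)) (g (Suc i)) ` free_vecs Y (n (Suc i))" for i
    using s[THEN spec, of i] unfolding sng by auto
  define a where "a i = (case i of 0 \<Rightarrow> [0] | Suc i \<Rightarrow> replicate (n i) (int (d + i)))" for i
  define \<delta> where "\<delta> i = comb (n i) (g i)" for i
  define \<epsilon> where "\<epsilon> x = I +>\<^bsub>poly_ring Y\<^esub> (x 0)" for x :: "nat \<Rightarrow> ('v, 'k) mpoly"
  have a0: "a 0 = [0]" and aS: "a (Suc i) = replicate (n i) (int (d + i))" for i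
    by (simp_all add: a_def)
  have len: "length (a 0) = 1" "length (a (Suc i)) = n i" for i by (simp_all add: a0 aS)
  note q = quotient_module_simps[OF I]
  note IR = ideal_poly_ringD[OF I]
  have ideal_vecs_free: "ideal_vecs I = {x \<in> free_vecs Y 1. x 0 \<in> I}"
    using IR(1) by (auto simp: ideal_vecs_def free_vecs_1_iff)
  have \<delta>_free: "\<delta> i x \<in> free_vecs Y (length (a i))" if "x \<in> free_vecs Y (n i)" for i x
  proof (cases i)
    case 0
    have "\<delta> 0 x \<in> ideal_vecs I" unfolding vecI \<delta>_def using that 0 by blast
    then show ?thesis using 0 len ideal_vecs_free by simp
  next
    case (Suc i')
    have "\<delta> i x \<in> syz Y (n i') (g i')" unfolding syzn \<delta>_def using that Suc by blast
    then show ?thesis using Suc len by (simp add: syz_def)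
  qed
  have \<epsilon>_hom: "\<epsilon> \<in> graded_hom (poly_ring Y) (graded_free Y (a 0)) (quotient_module Y I)"
    unfolding graded_hom_def graded_free_simps len
  proof (intro CollectI conjI ballI allI)
    show "\<epsilon> \<in> free_vecs Y 1 \<rightarrow> carrier (quotient_module Y I)"
      by (auto simp: q(1) \<epsilon>_def free_vecs_1_iff)
    fix x y :: "nat \<Rightarrow> ('v, 'k) mpoly" assume "x \<in> free_vecs Y 1" "y \<in> free_vecs Y 1"
    then show "\<epsilon> (x + y) = \<epsilon> x \<oplus>\<^bsub>quotient_module Y I\<^esub> \<epsilon> y"
      by (simp add: \<epsilon>_def q(2) free_vecs_1_iff)
  next
    fix r :: "('v, 'k) mpoly" and x :: "nat \<Rightarrow> ('v, 'k) mpoly" assume "r \<in> polys Y" "x \<in> free_vecs Y 1"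
    then show "\<epsilon> (r \<cdot> x) = r \<odot>\<^bsub>quotient_module Y I\<^esub> \<epsilon> x"
      by (simp add: \<epsilon>_def q(3) free_vecs_1_iff)
  next
    fix j
    show "\<epsilon> ` {x. (\<forall>b<1. x b \<in> homogeneous Y (j - a 0 ! b)) \<and> (\<forall>b\<ge>1. x b = 0)} \<subseteq>
        component (quotient_module Y I) j"
      by (auto simp: q(4) \<epsilon>_def a0)
  qed
  have \<delta>_hom: "\<delta> i \<in> graded_hom (poly_ring Y) (graded_free Y (a (Suc i))) (graded_free Y (a i))" for i
    unfolding graded_hom_def graded_free_simps len(2)
  proof (intro CollectI conjI ballI allI)
    show "\<delta> i \<in> free_vecs Y (n i) \<rightarrow> free_vecs Y (length (a i))" using \<delta>_free by blast
    show "\<delta> i (x + y) = \<delta> i x + \<delta> i y" for x y by (simp add: \<delta>_def comb_add)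
    show "\<delta> i (r \<cdot> x) = r \<cdot> \<delta> i x" for r x by (simp add: \<delta>_def comb_smul)
    fix j
    show "\<delta> i ` {x. (\<forall>b<n i. x b \<in> homogeneous Y (j - a (Suc i) ! b)) \<and> (\<forall>b\<ge>n i. x b = 0)} \<subseteq>
        {x. (\<forall>b<length (a i). x b \<in> homogeneous Y (j - a i ! b)) \<and> (\<forall>b\<ge>length (a i). x b = 0)}"
    proof clarify
      fix x :: "nat \<Rightarrow> ('v, 'k) mpoly"
      assume x: "\<forall>b<n i. x b \<in> homogeneous Y (j - a (Suc i) ! b)" "\<forall>b\<ge>n i. x b = 0"
      have xh: "x b \<in> homogeneous Y (j - int (d + i))" for b
        using x by (cases "b < n i") (auto simp: aS)
      have xf: "x \<in> free_vecs Y (n i)"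
        using x(2) homogeneous_polys[OF xh] by (auto simp: free_vecs_def)
      have h: "\<delta> i x \<in> hom_vecs Y (?q i + (j - int (d + i)))"
        unfolding \<delta>_def using xh by (intro comb_hom ghom) (auto simp: hom_vecs_def)
      have "\<delta> i x b \<in> homogeneous Y (j - a i ! b)" if "b < length (a i)" for b
      proof -
        have "?q i + (j - int (d + i)) = j - a i ! b"
          using that by (cases i) (auto simp: a0 aS)
        from h[unfolded this] show ?thesis by (simp add: hom_vecs_def)
      qed
      moreover have "\<forall>b\<ge>length (a i). \<delta> i x b = 0"
        using \<delta>_free[OF xf] by (simp add: free_vecs_def)
      ultimately show "(\<forall>b<length (a i). \<delta> i x b \<in> homogeneous Y (j - a i ! b)) \<and>
          (\<forall>b\<ge>length (a i). \<delta> i x b = 0)" by blast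
    qed
  qed
  have "minimal_graded_free_resolution Y (quotient_module Y I) a \<delta> \<epsilon>"
    unfolding minimal_graded_free_resolution_def
  proof (intro conjI allI ballI impI)
    show "\<epsilon> ` carrier (graded_free Y (a 0)) = carrier (quotient_module Y I)"
      unfolding graded_free_simps len q(1)
    proof
      show "\<epsilon> ` free_vecs Y 1 \<subseteq> (+>\<^bsub>poly_ring Y\<^esub>) I ` polys Y"
        by (auto simp: \<epsilon>_def free_vecs_1_iff)
      show "(+>\<^bsub>poly_ring Y\<^esub>) I ` polys Y \<subseteq> \<epsilon> ` free_vecs Y 1"
      proof clarify
        fix p :: "('v, 'k) mpoly" assume "p \<in> polys Y"
        then show "I +>\<^bsub>poly_ring Y\<^esub> p \<in> \<epsilon> ` free_vecs Y 1"
          by (intro image_eqI[of _ _ "\<lambda>i. if i = 0 then p else 0"]) (auto simp: \<epsilon>_def free_vecs_1_iff)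
      qed
    qed
    have "\<delta> 0 ` carrier (graded_free Y (a 1)) = ideal_vecs I"
      unfolding One_nat_def graded_free_simps len vecI \<delta>_def ..
    also have "\<dots> = a_kernel (graded_free Y (a 0)) (quotient_module Y I) \<epsilon>"
      unfolding a_kernel_def' graded_free_simps len ideal_vecs_free
      using q(5) by (auto simp: \<epsilon>_def free_vecs_1_iff)
    finally show "\<delta> 0 ` carrier (graded_free Y (a 1)) = a_kernel (graded_free Y (a 0)) (quotient_module Y I) \<epsilon>" .
    show "\<delta> (Suc i) ` carrier (graded_free Y (a (Suc (Suc i)))) =
          a_kernel (graded_free Y (a (Suc i))) (graded_free Y (a i)) (\<delta> i)" for i
      unfolding a_kernel_def' graded_free_simps len \<delta>_def syzn[symmetric] by (simp add: syz_def)
    fix i b and x :: "nat \<Rightarrow> ('v, 'k) mpoly" assume "x \<in> carrier (graded_free Y (a (Suc i)))"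
    then show "\<delta> i x b \<in> irrelevant_ideal Y"
      unfolding \<delta>_def graded_free_simps len
      using d by (intro comb_irrelevant[of "n i" "g i" Y "?q i"] ghom) auto
  qed (rule \<epsilon>_hom \<delta>_hom)+
  moreover have "\<forall>i. set (a (Suc i)) \<subseteq> {int (d + i)}" by (auto simp: aS)
  ultimately show ?thesis by blast
qed

section \<open>Every minimal resolution is linear\<close>

text \<open>
  Let \<open>f\<close> map a free module onto \<open>M\<close> with kernel in the multiples of the irrelevant ideal.  The image of
  a basis vector is not zero, so its degree is at least \<open>q\<close>.  If it were larger, the image would be
  a combination of generators of \<open>M\<close> with coefficients in the irrelevant ideal, and lifting this
  combination would produce an element of the kernel with a coefficient outside this ideal.  So the images of
  the basis vectors are minimal generators of \<open>M\<close>, and the kernel is their relation module.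
\<close>

lemma minimal_cover:
  fixes f :: "(nat \<Rightarrow> ('v, 'k::field) mpoly) \<Rightarrow> nat \<Rightarrow> ('v, 'k) mpoly"
  assumes M: "linear_module Y q M" and f: "lin_on Y (free_vecs Y n) f" and img: "f ` free_vecs Y n = M"
    and deg: "\<forall>b<n. f (unit_vec b) \<in> hom_vecs Y (t b)"
    and min: "\<forall>x\<in>free_vecs Y n. f x = 0 \<longrightarrow> (\<forall>b<n. x b \<in> irrelevant_ideal Y)"
  shows "\<forall>b<n. t b = q" and "linear_module Y 1 {x \<in> free_vecs Y n. f x = 0}"
proof -
  note F = submod_free[of Y n]
  have fM: "f x \<in> M" if "x \<in> free_vecs Y n" for x using img that by blast
  show *: "\<forall>b<n. t b = q"
  proof (intro allI impI)
    fix b assume b: "b < n"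
    note ub = unit_vec_free[OF b, of Y]
    show "t b = q"
    proof (rule ccontr)
      assume "t b \<noteq> q"
      then consider "t b < q" | "q < t b" by linarith
      then show False
      proof cases
        case 1
        have "f (unit_vec b) = 0" by (rule linear_below_degree[OF M fM[OF ub] deg[rule_format, OF b] 1])
        from min[rule_format, OF ub this b] show False by (simp add: unit_vec_def)
      next
        case 2
        obtain m g where g: "\<And>i. i < m \<Longrightarrow> g i \<in> hom_vecs Y q" "M = comb m g ` free_vecs Y m"
          using M by (rule linear_moduleE) blast
        obtain c0 where c0: "c0 \<in> free_vecs Y m" "comb m g c0 = f (unit_vec b)"
          using fM[OF ub] g(2) by auto
        have "comb m g c0 \<in> hom_vecs Y (q + (t b - q))" using deg[rule_format, OF b] c0 by simp
        from lift_homogeneous[OF g(1) c0(1) this] obtain c where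
          c: "c \<in> free_vecs Y m" "c \<in> hom_vecs Y (t b - q)" "comb m g c = f (unit_vec b)"
          using c0(2) by metis
        have "\<exists>y. y \<in> free_vecs Y n \<and> f y = g i" if "i < m" for i
          using gen_mem[OF that, of g Y] unfolding g(2)[symmetric] img[symmetric] by auto
        then obtain y where y: "\<And>i. i < m \<Longrightarrow> y i \<in> free_vecs Y n" "\<And>i. i < m \<Longrightarrow> f (y i) = g i"
          by metis
        have yc: "comb m y c \<in> free_vecs Y n" by (rule comb_mem[OF F y(1) c(1)])
        have "f (comb m y c) = comb m (\<lambda>i. f (y i)) c" by (rule lin_on_comb[OF f F y(1) c(1)])
        also have "\<dots> = comb m g c" by (rule comb_cong) (simp_all add: y(2))
        finally have fy: "f (comb m y c) = f (unit_vec b)" using c(3) by simp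
        have "f (unit_vec b - comb m y c) = f (unit_vec b) - f (comb m y c)"
          by (rule lin_on_diff[OF f F ub yc])
        then have "f (unit_vec b - comb m y c) = 0" using fy by simp
        from min[rule_format, OF submod_diff[OF F ub yc] this b]
        have A: "1 - comb m y c b \<in> irrelevant_ideal Y" by (simp add: unit_vec_def)
        have "c i * y i b \<in> irrelevant_ideal Y" if "i < m" for i
          using c(2) 2 free_vecs_polys[OF y(1)[OF that]]
          by (intro irrelevant_mult homogeneous_irrelevant[of _ Y "t b - q"]) (auto simp: hom_vecs_def)
        then have "(\<Sum>i\<in>I. c i * y i b) \<in> irrelevant_ideal Y" if "I \<subseteq> {..<m}" for I
          using that by (induction I rule: infinite_finite_induct) (auto intro: irrelevant_add irrelevant_zero)
        then have "comb m y c b \<in> irrelevant_ideal Y" by (simp add: comb_def sum_apply)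
        from irrelevant_add[OF A this] show False by simp
      qed
    qed
  qed
  let ?h = "\<lambda>b. f (unit_vec b)"
  have fx: "f x = comb n ?h x" if x: "x \<in> free_vecs Y n" for x
  proof -
    have "f (comb n unit_vec x) = comb n ?h x"
      by (rule lin_on_comb[OF f F _ x]) (rule unit_vec_free)
    then show ?thesis by (simp add: comb_unit_vecs[OF x])
  qed
  have ker: "{x \<in> free_vecs Y n. f x = 0} = syz Y n ?h" using fx by (auto simp: syz_def)
  show "linear_module Y 1 {x \<in> free_vecs Y n. f x = 0}"
    unfolding ker
  proof (rule linear_syz_minimal)
    have "M = comb n ?h ` free_vecs Y n" using img fx by force
    then show "linear_module Y q (comb n ?h ` free_vecs Y n)" using M by simp
    show "?h i \<in> hom_vecs Y q" if "i < n" for i using deg[rule_format, OF that] * that by simp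
    fix c assume c: "c \<in> syz Y n ?h" "c \<in> hom_vecs Y 0"
    have "c b = 0" for b
    proof (cases "b < n")
      case True
      have "c b \<in> irrelevant_ideal Y" using c(1) True unfolding ker[symmetric] by (intro min[rule_format]) auto
      moreover have "c b \<in> homogeneous Y 0" using c(2) by (simp add: hom_vecs_def)
      ultimately show ?thesis by (rule irrelevant_homogeneous_0)
    qed (use c in \<open>simp add: syz_def free_vecs_def\<close>)
    then show "c = 0" by (simp add: fun_eq_iff)
  qed
qed

text \<open>
  The analogue of \<open>minimal_cover\<close> for the residue class ring itself, which is not a submodule of a
  free module.  It is generated by the class of \<open>1\<close>; the same argument shows that every
  basis vector has degree \<open>0\<close> and maps to the class of a non-zero constant, and that two basis vectors would
  satisfy a relation with constant coefficients.
\<close>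

lemma first_cover:
  fixes I :: "('v, 'k::field) mpoly set"
  assumes I: "ideal I (poly_ring Y)" and proper: "1 \<notin> I"
    and \<epsilon>: "\<epsilon> \<in> graded_hom (poly_ring Y) (graded_free Y a) (quotient_module Y I)"
    and surj: "\<epsilon> ` carrier (graded_free Y a) = carrier (quotient_module Y I)"
    and min: "\<forall>x\<in>a_kernel (graded_free Y a) (quotient_module Y I) \<epsilon>. \<forall>b<length a.
      x b \<in> irrelevant_ideal Y"
  shows "a = [0]" and "a_kernel (graded_free Y a) (quotient_module Y I) \<epsilon> = ideal_vecs I"
proof -
  define n where "n = length a"
  define cl where "cl = (\<lambda>p. I +>\<^bsub>poly_ring Y\<^esub> p)"
  note q = quotient_module_simps[OF I, folded cl_def]
  note IR = ideal_poly_ringD[OF I]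
  let ?Q = "quotient_module Y I"
  let ?F = "free_vecs Y n :: (nat \<Rightarrow> ('v, 'k) mpoly) set"
  note F = submod_free[of Y n]
  have \<epsilon>_mem: "\<epsilon> x \<in> cl ` polys Y" if "x \<in> ?F" for x
    using surj that by (auto simp: graded_free_simps q(1) n_def)
  have \<epsilon>_add: "\<epsilon> (x + y) = \<epsilon> x \<oplus>\<^bsub>?Q\<^esub> \<epsilon> y" if "x \<in> ?F" "y \<in> ?F" for x y
    using \<epsilon> that by (auto simp: graded_hom_def graded_free_simps n_def)
  have \<epsilon>_smul: "\<epsilon> (r \<cdot> x) = r \<odot>\<^bsub>?Q\<^esub> \<epsilon> x" if "r \<in> polys Y" "x \<in> ?F" for r x
    using \<epsilon> that by (auto simp: graded_hom_def graded_free_simps n_def)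
  have ker: "a_kernel (graded_free Y a) ?Q \<epsilon> = {x \<in> ?F. \<epsilon> x = \<zero>\<^bsub>?Q\<^esub>}"
    by (simp add: a_kernel_def' graded_free_simps n_def)
  have min': "x b \<in> irrelevant_ideal Y" if "x \<in> ?F" "\<epsilon> x = cl p" "p \<in> I" "b < n" for x p b
    using that q(5)[of p] IR(1) by (intro min[rule_format]) (auto simp: ker n_def)
  have \<epsilon>_comb: "\<epsilon> (r \<cdot> x + s \<cdot> y) = cl (r * p + s * p')"
    if "r \<in> polys Y" "s \<in> polys Y" "x \<in> ?F" "y \<in> ?F" "\<epsilon> x = cl p" "\<epsilon> y = cl p'" "p \<in> polys Y" "p' \<in> polys Y"
    for r s x y p p'
  proof -
    have "\<epsilon> (r \<cdot> x + s \<cdot> y) = \<epsilon> (r \<cdot> x) \<oplus>\<^bsub>?Q\<^esub> \<epsilon> (s \<cdot> y)"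
      using that by (intro \<epsilon>_add submod_smul[OF F])
    also have "\<dots> = cl (r * p) \<oplus>\<^bsub>?Q\<^esub> cl (s * p')" using that by (simp add: \<epsilon>_smul q(3))
    also have "\<dots> = cl (r * p + s * p')" using that by (intro q(2)) auto
    finally show ?thesis .
  qed
  have "cl 1 \<in> \<epsilon> ` ?F" using surj by (simp add: graded_free_simps q(1) n_def)
  then obtain y where y: "y \<in> ?F" "\<epsilon> y = cl 1" by auto
  have "\<exists>p. p \<in> homogeneous Y (a ! b) \<and> \<epsilon> (unit_vec b) = cl p" if b: "b < n" for b
  proof -
    have "unit_vec b \<in> component (graded_free Y a) (a ! b)"
      using b by (auto simp: graded_free_simps unit_vec_def n_def)
    then have "\<epsilon> (unit_vec b) \<in> component ?Q (a ! b)"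
      using \<epsilon> unfolding graded_hom_def by blast
    then show ?thesis by (auto simp: q(4))
  qed
  then obtain p where p: "\<And>b. b < n \<Longrightarrow> p b \<in> homogeneous Y (a ! b)" "\<And>b. b < n \<Longrightarrow> \<epsilon> (unit_vec b) = cl (p b)"
    by metis
  have pR: "p b \<in> polys Y" if "b < n" for b by (rule homogeneous_polys[OF p(1)[OF that]])
  have deg: "a ! b = 0" if b: "b < n" for b
  proof (rule ccontr)
    assume nz: "a ! b \<noteq> 0"
    note ub = unit_vec_free[OF b, of Y]
    let ?x = "1 \<cdot> unit_vec b + (- p b) \<cdot> y"
    have x: "?x \<in> ?F"
      using ub y(1) pR[OF b] by (intro submod_add[OF F] submod_smul[OF F]) auto
    have "\<epsilon> ?x = cl (1 * p b + (- p b) * 1)"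
      using ub y p(2)[OF b] pR[OF b] by (intro \<epsilon>_comb) auto
    then have "\<epsilon> ?x = cl 0" by simp
    from min'[OF x this IR(2) b] have A: "1 - p b * y b \<in> irrelevant_ideal Y"
      by (simp add: unit_vec_def)
    have "p b * y b \<in> irrelevant_ideal Y"
      using homogeneous_irrelevant[OF p(1)[OF b] nz] free_vecs_polys[OF y(1)] by (rule irrelevant_mult)
    from irrelevant_add[OF A this] show False by simp
  qed
  have p0: "p b \<in> homogeneous Y 0" if "b < n" for b using p(1)[OF that] deg[OF that] by simp
  have pnz: "p b \<noteq> 0" if b: "b < n" for b
  proof
    assume "p b = 0"
    then have "\<epsilon> (unit_vec b) = cl 0" using p(2)[OF b] by simp
    from min'[OF unit_vec_free[OF b] this IR(2) b] show False
      by (simp add: unit_vec_def)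
  qed
  have "n \<noteq> 0"
  proof
    assume "n = 0"
    then have "y = 0 \<cdot> y" using y(1) by (simp add: free_vecs_0)
    then have "\<epsilon> y = 0 \<odot>\<^bsub>?Q\<^esub> cl 1" using \<epsilon>_smul[OF polys_zero y(1)] y(2) by simp
    then have "cl 1 = cl 0" using y(2) q(3)[of 0 1] by simp
    then show False using q(5)[of 1] q(5)[of 0] IR(2) proper by simp
  qed
  moreover have "\<not> 2 \<le> n"
  proof
    assume n: "2 \<le> n"
    let ?x = "p 1 \<cdot> unit_vec 0 + (- p 0) \<cdot> unit_vec 1"
    have b: "0 < n" "1 < n" using n by auto
    have x: "?x \<in> ?F"
      using b pR by (intro submod_add[OF F] submod_smul[OF F] unit_vec_free) auto
    have "\<epsilon> ?x = cl (p 1 * p 0 + (- p 0) * p 1)"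
      using b pR p(2) by (intro \<epsilon>_comb unit_vec_free) auto
    then have "\<epsilon> ?x = cl 0" by (simp add: mult.commute)
    from min'[OF x this IR(2) b(1)] have "p 1 \<in> irrelevant_ideal Y" by (simp add: unit_vec_def)
    then show False using irrelevant_homogeneous_0[OF _ p0[OF b(2)]] pnz[OF b(2)] by blast
  qed
  ultimately have n: "n = 1" by linarith
  then obtain z where "a = [z]" by (auto simp: n_def length_Suc_conv)
  then show a: "a = [0]" using deg[of 0] n by simp
  have b: "0 < n" using n by simp
  obtain u where u: "u \<in> homogeneous Y 0" "u * p 0 = 1"
    using homogeneous_0_inverse[OF p0[OF b] pnz[OF b]] by blast
  have \<epsilon>x: "\<epsilon> x = cl (x 0 * p 0)" if x: "x \<in> ?F" for x
  proof -
    have "x = x 0 \<cdot> unit_vec 0" using x unfolding n One_nat_def free_vecs_1_iff by (auto simp: unit_vec_def fun_eq_iff)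
    then have "\<epsilon> x = x 0 \<odot>\<^bsub>?Q\<^esub> \<epsilon> (unit_vec 0)"
      using \<epsilon>_smul[OF free_vecs_polys[OF x, of 0] unit_vec_free[OF b]] by metis
    then show ?thesis using p(2)[OF b] q(3)[OF free_vecs_polys[OF x] pR[OF b]] by simp
  qed
  have I_iff: "r * p 0 \<in> I \<longleftrightarrow> r \<in> I" if "r \<in> polys Y" for r
  proof
    assume "r * p 0 \<in> I"
    then have "u * (r * p 0) \<in> I" using IR(4) homogeneous_polys[OF u(1)] by blast
    moreover have "u * (r * p 0) = r * (u * p 0)" by (simp only: mult_ac)
    ultimately show "r \<in> I" using u(2) by simp
  next
    assume "r \<in> I"
    then show "r * p 0 \<in> I" using IR(4)[of "p 0" r] pR[OF b] by (simp add: mult.commute)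
  qed
  have "\<epsilon> x = \<zero>\<^bsub>?Q\<^esub> \<longleftrightarrow> x 0 \<in> I" if x: "x \<in> ?F" for x
    using \<epsilon>x[OF x] q(5)[of "x 0 * p 0"] I_iff free_vecs_polys[OF x] pR[OF b] by auto
  then show "a_kernel (graded_free Y a) ?Q \<epsilon> = ideal_vecs I"
    unfolding ker using n IR(1) by (auto simp: ideal_vecs_def free_vecs_1_iff)
qed

text \<open>
  By induction along the resolution the image of each differential is linear, and \<open>minimal_cover\<close>
  determines the degrees of the basis of the next free module.  The image of \<open>\<delta> i\<close> for \<open>i > 0\<close> is linear in degree
  \<open>1\<close> in the unshifted grading of the free module that contains it, whose basis has degree
  \<open>d + i - 1\<close>; this is the shift \<open>s\<close> in the inductive step.
\<close>

lemma minimal_resolution_linear: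
  fixes I :: "('v, 'k::field) mpoly set"
  assumes I: "ideal I (poly_ring Y)" and lin: "linear_module Y (int d) (ideal_vecs I)" and d: "1 \<le> d"
    and res: "minimal_graded_free_resolution Y (quotient_module Y I) a \<delta> \<epsilon>"
  shows "set (a (Suc i)) \<subseteq> {int (d + i)}"
proof -
  let ?F = "\<lambda>i. free_vecs Y (length (a i)) :: (nat \<Rightarrow> ('v, 'k) mpoly) set"
  have \<epsilon>: "\<epsilon> \<in> graded_hom (poly_ring Y) (graded_free Y (a 0)) (quotient_module Y I)"
    and \<delta>: "\<And>i. \<delta> i \<in> graded_hom (poly_ring Y) (graded_free Y (a (Suc i))) (graded_free Y (a i))"
    and surj: "\<epsilon> ` carrier (graded_free Y (a 0)) = carrier (quotient_module Y I)"
    and ex0: "\<delta> 0 ` ?F 1 = a_kernel (graded_free Y (a 0)) (quotient_module Y I) \<epsilon>"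
    and ex: "\<And>i. \<delta> (Suc i) ` ?F (Suc (Suc i)) = {x \<in> ?F (Suc i). \<delta> i x = 0}"
    and min: "\<And>i x b. x \<in> ?F (Suc i) \<Longrightarrow> b < length (a i) \<Longrightarrow> \<delta> i x b \<in> irrelevant_ideal Y"
    using res unfolding minimal_graded_free_resolution_def
    by (simp_all add: graded_free_simps a_kernel_def')
  have proper: "1 \<notin> I"
  proof
    assume "1 \<in> I"
    then have "unit_vec 0 \<in> ideal_vecs I" by (simp add: ideal_vecs_def unit_vec_def)
    from linear_below_degree[OF lin this unit_vec_hom] have "unit_vec 0 = (0 :: nat \<Rightarrow> ('v, 'k) mpoly)"
      using d by simp
    then have "unit_vec 0 0 = (0 :: ('v, 'k) mpoly)" by simp
    then show False by (simp add: unit_vec_def)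
  qed
  have "\<forall>x\<in>a_kernel (graded_free Y (a 0)) (quotient_module Y I) \<epsilon>. \<forall>b<length (a 0).
      x b \<in> irrelevant_ideal Y"
    using min[of _ 0] unfolding ex0[symmetric] by auto
  note first = first_cover[OF I proper \<epsilon> surj this]
  have \<delta>_lin: "lin_on Y (?F (Suc i)) (\<delta> i)" and \<delta>_free: "x \<in> ?F (Suc i) \<Longrightarrow> \<delta> i x \<in> ?F i" for i x
    using \<delta>[of i] by (auto simp: graded_hom_def graded_free_simps lin_on_def)
  have step: "(\<forall>b<length (a (Suc i)). a (Suc i) ! b = q + s) \<and> linear_module Y 1 (\<delta> (Suc i) ` ?F (Suc (Suc i)))"
    if s: "\<forall>b<length (a i). a i ! b = s" and M: "linear_module Y q (\<delta> i ` ?F (Suc i))" for i q s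
  proof -
    let ?t = "\<lambda>b. a (Suc i) ! b - s"
    have deg: "\<forall>b<length (a (Suc i)). \<delta> i (unit_vec b) \<in> hom_vecs Y (?t b)"
    proof (intro allI impI)
      fix b assume b: "b < length (a (Suc i))"
      have "unit_vec b \<in> component (graded_free Y (a (Suc i))) (a (Suc i) ! b)"
        using b by (auto simp: graded_free_simps unit_vec_def)
      then have "\<delta> i (unit_vec b) \<in> component (graded_free Y (a i)) (a (Suc i) ! b)"
        using \<delta>[of i] unfolding graded_hom_def by blast
      then have c: "\<forall>c<length (a i). \<delta> i (unit_vec b) c \<in> homogeneous Y (?t b)"
          "\<forall>c\<ge>length (a i). \<delta> i (unit_vec b) c = 0"
        using s by (simp_all add: graded_free_simps)
      have "\<delta> i (unit_vec b) c \<in> homogeneous Y (?t b)" for c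
        using c by (cases "c < length (a i)") auto
      then show "\<delta> i (unit_vec b) \<in> hom_vecs Y (?t b)" by (simp add: hom_vecs_def)
    qed
    have mini: "\<forall>x\<in>?F (Suc i). \<delta> i x = 0 \<longrightarrow> (\<forall>b<length (a (Suc i)). x b \<in> irrelevant_ideal Y)"
    proof (intro ballI allI impI)
      fix x b assume x: "x \<in> ?F (Suc i)" "\<delta> i x = 0" "b < length (a (Suc i))"
      then have "x \<in> \<delta> (Suc i) ` ?F (Suc (Suc i))" unfolding ex by blast
      then show "x b \<in> irrelevant_ideal Y" using min x(3) by blast
    qed
    note c = minimal_cover[OF M \<delta>_lin refl deg mini]
    from c(1) have "\<forall>b<length (a (Suc i)). a (Suc i) ! b = q + s" by fastforce
    with c(2) show ?thesis unfolding ex by blast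
  qed
  have "(\<forall>b<length (a (Suc i)). a (Suc i) ! b = int (d + i)) \<and>
      linear_module Y 1 (\<delta> (Suc i) ` ?F (Suc (Suc i)))" for i
  proof (induction i)
    case 0
    have "linear_module Y (int d) (\<delta> 0 ` ?F (Suc 0))"
      using lin ex0 first(2) by simp
    from step[OF _ this, of 0] show ?case by (simp add: first(1))
  next
    case (Suc i)
    from step[OF conjunct1[OF Suc] conjunct2[OF Suc]] show ?case by simp
  qed
  then show ?thesis by (auto simp: in_set_conv_nth)
qed

text \<open>
  A Betti number is the unique value realized by all minimal resolutions.  That it vanishes
  therefore requires both a minimal resolution and the statement that in every minimal resolution the
  summand in question is absent.
\<close>

theorem has_linear_resolution_quotient:
  fixes I :: "('v, 'k::field) mpoly set"
  assumes "ideal I (poly_ring Y)" "linear_module Y (int d) (ideal_vecs I)" "1 \<le> d"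
  shows "has_linear_resolution Y (quotient_module Y I)"
  unfolding has_linear_resolution_def
proof (intro exI[of _ d] conjI allI impI assms(3))
  fix i :: nat and j :: int assume i: "0 < i" and j: "j \<noteq> int i + int d - 1"
  have zero: "count_list (a i) j = 0" if "minimal_graded_free_resolution Y (quotient_module Y I) a \<delta> \<epsilon>" for a \<delta> \<epsilon>
  proof -
    have "set (a i) \<subseteq> {int (d + (i - 1))}"
      using minimal_resolution_linear[OF assms that, of "i - 1"] i by simp
    moreover have "j \<noteq> int (d + (i - 1))" using i j by auto
    ultimately show ?thesis by (auto simp: count_list_0_iff)
  qed
  obtain a \<delta> \<epsilon> where "minimal_graded_free_resolution Y (quotient_module Y I) a \<delta> \<epsilon>"
    using linear_resolution_exists[OF assms] by blast
  then show "graded_betti Y (quotient_module Y I) i j = 0"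
    unfolding graded_betti_def using zero by (intro the_equality) (metis, metis)
qed

section \<open>Stanley-Reisner rings of generalized chordal hypergraphs\<close>

lemma nonfaces_upgen:
  "Pow X - hypergraph_complex d X E = upgen X (nsets X d - E)"
proof (intro equalityI subsetI)
  fix F assume "F \<in> Pow X - hypergraph_complex d X E"
  then obtain S where S: "F \<subseteq> X" "S \<in> nsets F d" "S \<notin> E" by (auto simp: hypergraph_complex_def)
  then have "S \<subseteq> F" "S \<in> nsets X d" by (auto simp: nsets_def)
  with S show "F \<in> upgen X (nsets X d - E)" by (auto simp: upgen_def)
next
  fix F assume "F \<in> upgen X (nsets X d - E)"
  then obtain S where S: "F \<subseteq> X" "S \<in> nsets X d" "S \<notin> E" "S \<subseteq> F" by (auto simp: upgen_def)
  then have "S \<in> nsets F d" by (auto simp: nsets_def)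
  with S show "F \<in> Pow X - hypergraph_complex d X E" by (auto simp: hypergraph_complex_def)
qed

theorem theorem5p1:
  fixes d :: nat and X :: "'v set" and E :: "'v set set"
  assumes "2 \<le> d"
    and "generalized_chordal d X E"
  shows "has_linear_resolution X
    (stanley_reisner_ring X (hypergraph_complex d X E) ::
      (('v, 'k::field) mpoly, ('v, 'k) mpoly set) graded_module)"
proof -
  let ?N = "upgen X (nsets X d - E)"
  let ?I = "sqfree ?N :: ('v, 'k) mpoly set"
  have "stanley_reisner_ideal X (hypergraph_complex d X E) = ?I"
    using stanley_reisner_ideal_eq_sqfree[of X "hypergraph_complex d X E"]
      upset_upgen[of X "nsets X d - E"] generalized_chordal_uniform(1)[OF assms(2)]
    by (simp add: nonfaces_upgen)
  moreover have "linear_module X (int d) (ideal_vecs ?I)"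
    using generalized_chordal_linear[OF assms(2,1) order_refl, where 'k = 'k]
    by (simp add: linear_family_def)
  then have "has_linear_resolution X (quotient_module X ?I)"
    using assms(1) by (intro has_linear_resolution_quotient[OF ideal_sqfree[OF upset_upgen]]) auto
  ultimately show ?thesis by (simp add: stanley_reisner_ring_def)
qed

end
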